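(* Let $k$ be a commutative unital ring, let $C$ be a multicomplex over $k$ with structure maps $d_i$, $i\geq 0$, and let $D=\mathrm{Tot}\,C$ be its associated filtered total complex. Let $r\geq 1$ and $p\in\mathbb{Z}$. Under the isomorphisms $\psi\colon \mathcal{Z}_r^{q,*}(D)/\mathcal{B}_r^{q,*}(D)\to Z_r^{q,*}/B_r^{q,*}$, $[x]_r\mapsto[(x)_q]$ (for $q=p$ and $q=p-r$), the $r$-th differential $\delta_r$ of the spectral sequence of the filtered complex $D$ corresponds to the map $$\Delta_r\colon Z_r^{p,*}/B_r^{p,*}\longrightarrow Z_r^{p-r,*}/B_r^{p-r,*}$$ (that is, $\psi\circ\delta_r=\Delta_r\circ\psi$) given by $$\Delta_r([x])=\left[\,d_rx-\sum_{i=1}^{r-1}d_iz_{p-r+i}\,\right],$$ where $x\in Z_r^{p,*}$ and $\{z_{p-j}\}_{1\leq j\leq r-1}$ is a family with $z_{p-j}\in C_{p-j,*}$ satisfying $d_0x=0$ and $d_nx=\sum_{i=0}^{n-1}d_iz_{p-n+i}$ for all $1\leq n\leq r-1$.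
   Context: A multicomplex over $k$ is a $(\mathbb{Z},\mathbb{Z})$-graded $k$-module $C=(C_{a,b})_{a,b\in\mathbb{Z}}$ with $k$-linear maps $d_i\colon C\to C$, $i\geq 0$, of bidegree $(-i,i-1)$ (i.e. $d_i\colon C_{a,b}\to C_{a-i,b+i-1}$) such that $\sum_{i+j=n}d_id_j=0$ for all $n\geq 0$. For $p\in\mathbb{Z}$, $C_{p,*}$ denotes the graded $k$-module with components $C_{p,b}$, $b\in\mathbb{Z}$. Total complex: $D=\mathrm{Tot}\,C$ is the chain complex with $$(\mathrm{Tot}\,C)_n=\prod_{a+b=n,\ a\leq 0}C_{a,b}\ \oplus\bigoplus_{a+b=n,\ a>0}C_{a,b},$$ and differential $d$ given for $c\in(\mathrm{Tot}\,C)_n$ by $(dc)_a=\sum_{i\geq 0}d_i(c)_{a+i}$, where $(c)_a$ denotes the projection of $c$ to $C_{a,*}$ (the sum is finite since $(c)_j=0$ for $j$ sufficiently large). It is filtered by the subcomplexes $F_pD$, $p\in\mathbb{Z}$, with $(F_pD)_n=\prod_{a+b=n,\ a\leq p}C_{a,b}$. Spectral sequence of the filtered complex $D$: set $\mathcal{Z}_r^{p,*}(D)=F_pD\cap d^{-1}(F_{p-r}D)$ for $r\geq 0$, and $\mathcal{B}_r^{p,*}(D)=\mathcal{Z}_{r-1}^{p-1,*}(D)+d\,\mathcal{Z}_{r-1}^{p+r-1,*}(D)$ for $r\geq 1$. The $r$-th page is $E_r^{p,*}(D)=\mathcal{Z}_r^{p,*}(D)/\mathcal{B}_r^{p,*}(D)$,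 the class of $x\in\mathcal{Z}_r^{p,*}(D)$ is denoted $[x]_r$, and the $r$-th differential is $\delta_r\colon E_r^{p,*}(D)\to E_r^{p-r,*}(D)$, $\delta_r([x]_r)=[dx]_r$. For $p\in\mathbb{Z}$ and $r\geq 1$, define graded submodules $B_r^{p,*}\subseteq Z_r^{p,*}$ of $C_{p,*}$ as follows, for $x\in C_{p,*}$. (1) $x\in Z_r^{p,*}$ if and only if for each $1\leq j\leq r-1$ there exists $z_{p-j}\in C_{p-j,*}$ such that $$d_0x=0\quad\text{and}\quad d_nx=\sum_{i=0}^{n-1}d_iz_{p-n+i}\ \text{ for all } 1\leq n\leq r-1.$$ (2) $x\in B_r^{p,*}$ if and only if for each $0\leq j\leq r-1$ there exists $c_{p+j}\in C_{p+j,*}$ such that $$x=\sum_{j=0}^{r-1}d_jc_{p+j}\quad\text{and}\quad 0=\sum_{j=l}^{r-1}d_{j-l}c_{p+j}\ \text{ for all } 1\leq l\leq r-1.$$ The map $\psi\colon \mathcal{Z}_r^{p,*}(D)/\mathcal{B}_r^{p,*}(D)\to Z_r^{p,*}/B_r^{p,*}$, $[x]_r\mapsto[(x)_p]$, is a well-defined isomorphism for all $r\geq 1$ and $p\in\mathbb{Z}$. Square brackets without subscript denote classes in $Z_r^{q,*}/B_r^{q,*}$. *)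

theory Defs
  imports "HOL-Algebra.Module" "HOL-Algebra.AbelCoset"
begin

section \<open>Linear maps and subquotients of modules\<close>

definition linear_maps ::
    "('k, 'x) ring_scheme \<Rightarrow> ('k, 'm, 'y) module_scheme \<Rightarrow> ('k, 'n, 'z) module_scheme \<Rightarrow> ('m \<Rightarrow> 'n) set"
  where "linear_maps R M N =
    {f \<in> carrier M \<rightarrow> carrier N.
       (\<forall>x\<in>carrier M. \<forall>y\<in>carrier M. f (x \<oplus>\<^bsub>M\<^esub> y) = f x \<oplus>\<^bsub>N\<^esub> f y) \<and>
       (\<forall>s\<in>carrier R. \<forall>x\<in>carrier M. f (s \<odot>\<^bsub>M\<^esub> x) = s \<odot>\<^bsub>N\<^esub> f x)}"

definition linear_isos ::
    "('k, 'x) ring_scheme \<Rightarrow> ('k, 'm, 'y) module_scheme \<Rightarrow> ('k, 'n, 'z) module_scheme \<Rightarrow> ('m \<Rightarrow> 'n) set"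
  where "linear_isos R M N = {f \<in> linear_maps R M N. bij_betw f (carrier M) (carrier N)}"

text \<open>The module \<open>Z / B\<close> for submodules \<open>B \<subseteq> Z\<close> of \<open>M\<close>; its elements are cosets of \<open>B\<close>.
  The fields \<open>mult\<close> and \<open>one\<close> come from the record type and play no role for a module.\<close>

definition subquotient ::
    "('k, 'm, 'y) module_scheme \<Rightarrow> 'm set \<Rightarrow> 'm set \<Rightarrow> ('k, 'm set) module"
  where "subquotient M Z B =
    \<lparr>carrier = (\<lambda>x. B +>\<^bsub>M\<^esub> x) ` Z, mult = (\<lambda>_ _. undefined), one = undefined,
     zero = B, add = (\<lambda>X Y. X <+>\<^bsub>M\<^esub> Y),
     smult = (\<lambda>s X. \<Union>x\<in>X. B +>\<^bsub>M\<^esub> (s \<odot>\<^bsub>M\<^esub> x))\<rparr>"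


section \<open>Multicomplexes\<close>

text \<open>\<open>d i a b\<close> is the component \<open>C a b \<rightarrow> C (a - i) (b + i - 1)\<close> of the structure map \<open>d\<^sub>i\<close>.\<close>

locale multicomplex =
  fixes R :: "('k, 'x) ring_scheme"
    and C :: "int \<Rightarrow> int \<Rightarrow> ('k, 'm, 'y) module_scheme"
    and d :: "nat \<Rightarrow> int \<Rightarrow> int \<Rightarrow> 'm \<Rightarrow> 'm"
  assumes base_ring: "cring R"
    and component_module: "\<And>a b. module R (C a b)"
    and structure_map_linear:
      "\<And>i a b. d i a b \<in> linear_maps R (C a b) (C (a - int i) (b + int i - 1))"
    and structure_relation:
      "\<And>n a b x. x \<in> carrier (C a b) \<Longrightarrow>
         (\<Oplus>\<^bsub>C (a - int n) (b + int n - 2)\<^esub>i\<in>{..n}.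
            d i (a - int (n - i)) (b + int (n - i) - 1) (d (n - i) a b x))
         = \<zero>\<^bsub>C (a - int n) (b + int n - 2)\<^esub>"


section \<open>The total complex and its filtration\<close>

text \<open>An element of \<open>(Tot C)\<^sub>n\<close> is the family \<open>x\<close> of its components \<open>x a \<in> C a (n - a)\<close>.
  The direct sum over \<open>a > 0\<close> is expressed by finiteness of the support there.\<close>

definition Tot :: "(int \<Rightarrow> int \<Rightarrow> ('k, 'm, 'y) module_scheme) \<Rightarrow> int \<Rightarrow> ('k, int \<Rightarrow> 'm) module"
  where "Tot C n =
    \<lparr>carrier = {x. (\<forall>a. x a \<in> carrier (C a (n - a))) \<and>
                   finite {a. a > 0 \<and> x a \<noteq> \<zero>\<^bsub>C a (n - a)\<^esub>}},
     mult = (\<lambda>_ _. undefined), one = undefined,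
     zero = (\<lambda>a. \<zero>\<^bsub>C a (n - a)\<^esub>),
     add = (\<lambda>x y a. x a \<oplus>\<^bsub>C a (n - a)\<^esub> y a),
     smult = (\<lambda>s x a. s \<odot>\<^bsub>C a (n - a)\<^esub> x a)\<rparr>"

text \<open>For \<open>x\<close> in \<open>(Tot C)\<^sub>n\<close> the index set of the sum below is finite, and all omitted terms vanish.\<close>

definition tot_diff ::
    "(int \<Rightarrow> int \<Rightarrow> ('k, 'm, 'y) module_scheme) \<Rightarrow> (nat \<Rightarrow> int \<Rightarrow> int \<Rightarrow> 'm \<Rightarrow> 'm)
       \<Rightarrow> int \<Rightarrow> (int \<Rightarrow> 'm) \<Rightarrow> (int \<Rightarrow> 'm)"
  where "tot_diff C d n x = (\<lambda>a.
    \<Oplus>\<^bsub>C a (n - 1 - a)\<^esub>i\<in>{i. x (a + int i) \<noteq> \<zero>\<^bsub>C (a + int i) (n - (a + int i))\<^esub>}.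
       d i (a + int i) (n - (a + int i)) (x (a + int i)))"

definition Tot_filt ::
    "(int \<Rightarrow> int \<Rightarrow> ('k, 'm, 'y) module_scheme) \<Rightarrow> int \<Rightarrow> int \<Rightarrow> (int \<Rightarrow> 'm) set"
  where "Tot_filt C p n = {x \<in> carrier (Tot C n). \<forall>a>p. x a = \<zero>\<^bsub>C a (n - a)\<^esub>}"


section \<open>The spectral sequence of the filtered total complex\<close>

text \<open>Everything is graded by the total degree \<open>n\<close>.\<close>

definition cycles_tot ::
    "(int \<Rightarrow> int \<Rightarrow> ('k, 'm, 'y) module_scheme) \<Rightarrow> (nat \<Rightarrow> int \<Rightarrow> int \<Rightarrow> 'm \<Rightarrow> 'm)
       \<Rightarrow> nat \<Rightarrow> int \<Rightarrow> int \<Rightarrow> (int \<Rightarrow> 'm) set"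
  where "cycles_tot C d r p n =
    {x \<in> Tot_filt C p n. tot_diff C d n x \<in> Tot_filt C (p - int r) (n - 1)}"

text \<open>Only meaningful for \<open>r \<ge> 1\<close>.\<close>

definition boundaries_tot ::
    "(int \<Rightarrow> int \<Rightarrow> ('k, 'm, 'y) module_scheme) \<Rightarrow> (nat \<Rightarrow> int \<Rightarrow> int \<Rightarrow> 'm \<Rightarrow> 'm)
       \<Rightarrow> nat \<Rightarrow> int \<Rightarrow> int \<Rightarrow> (int \<Rightarrow> 'm) set"
  where "boundaries_tot C d r p n =
    cycles_tot C d (r - 1) (p - 1) n
      <+>\<^bsub>Tot C n\<^esub> tot_diff C d (n + 1) ` cycles_tot C d (r - 1) (p + int r - 1) (n + 1)"

definition page_tot ::
    "(int \<Rightarrow> int \<Rightarrow> ('k, 'm, 'y) module_scheme) \<Rightarrow> (nat \<Rightarrow> int \<Rightarrow> int \<Rightarrow> 'm \<Rightarrow> 'm)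
       \<Rightarrow> nat \<Rightarrow> int \<Rightarrow> int \<Rightarrow> ('k, (int \<Rightarrow> 'm) set) module"
  where "page_tot C d r p n =
    subquotient (Tot C n) (cycles_tot C d r p n) (boundaries_tot C d r p n)"

definition class_tot ::
    "(int \<Rightarrow> int \<Rightarrow> ('k, 'm, 'y) module_scheme) \<Rightarrow> (nat \<Rightarrow> int \<Rightarrow> int \<Rightarrow> 'm \<Rightarrow> 'm)
       \<Rightarrow> nat \<Rightarrow> int \<Rightarrow> int \<Rightarrow> (int \<Rightarrow> 'm) \<Rightarrow> (int \<Rightarrow> 'm) set"
  where "class_tot C d r p n x = boundaries_tot C d r p n +>\<^bsub>Tot C n\<^esub> x"

definition page_diff ::
    "(int \<Rightarrow> int \<Rightarrow> ('k, 'm, 'y) module_scheme) \<Rightarrow> (nat \<Rightarrow> int \<Rightarrow> int \<Rightarrow> 'm \<Rightarrow> 'm)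
       \<Rightarrow> nat \<Rightarrow> int \<Rightarrow> int \<Rightarrow> (int \<Rightarrow> 'm) set \<Rightarrow> (int \<Rightarrow> 'm) set"
  where "page_diff C d r p n X =
    the_elem ((\<lambda>x. class_tot C d r (p - int r) (n - 1) (tot_diff C d n x)) ` X)"


section \<open>The description in terms of the multicomplex\<close>

text \<open>\<open>zigzag C d r p b x z\<close>: \<open>x \<in> C\<^bsub>p,b\<^esub>\<close>, and the family \<open>z\<close>, indexed so that \<open>z (p - j)\<close> lies in
  \<open>C\<^bsub>p-j,*\<^esub>\<close>, satisfies the conditions defining membership of \<open>x\<close> in \<open>Z\<^sub>r\<^bsup>p,*\<^esup>\<close>. As the \<open>d\<^sub>i\<close> lower the
  total degree by one, \<open>z (p - j)\<close> is homogeneous of the same total degree \<open>p + b\<close> as \<open>x\<close>.\<close>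

definition zigzag ::
    "(int \<Rightarrow> int \<Rightarrow> ('k, 'm, 'y) module_scheme) \<Rightarrow> (nat \<Rightarrow> int \<Rightarrow> int \<Rightarrow> 'm \<Rightarrow> 'm)
       \<Rightarrow> nat \<Rightarrow> int \<Rightarrow> int \<Rightarrow> 'm \<Rightarrow> (int \<Rightarrow> 'm) \<Rightarrow> bool"
  where "zigzag C d r p b x z \<longleftrightarrow>
    x \<in> carrier (C p b) \<and>
    (\<forall>j\<in>{1..r - 1}. z (p - int j) \<in> carrier (C (p - int j) (b + int j))) \<and>
    d 0 p b x = \<zero>\<^bsub>C p (b - 1)\<^esub> \<and>
    (\<forall>n\<in>{1..r - 1}. d n p b x =
       (\<Oplus>\<^bsub>C (p - int n) (b + int n - 1)\<^esub>i\<in>{0..n - 1}.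
          d i (p - int n + int i) (b + int n - int i) (z (p - int n + int i))))"

definition cycles ::
    "(int \<Rightarrow> int \<Rightarrow> ('k, 'm, 'y) module_scheme) \<Rightarrow> (nat \<Rightarrow> int \<Rightarrow> int \<Rightarrow> 'm \<Rightarrow> 'm)
       \<Rightarrow> nat \<Rightarrow> int \<Rightarrow> int \<Rightarrow> 'm set"
  where "cycles C d r p b = {x. \<exists>z. zigzag C d r p b x z}"

text \<open>Here \<open>c (p + j)\<close> has total degree \<open>p + b + 1\<close>, one more than \<open>x\<close>. Only meaningful for \<open>r \<ge> 1\<close>.\<close>

definition boundaries ::
    "(int \<Rightarrow> int \<Rightarrow> ('k, 'm, 'y) module_scheme) \<Rightarrow> (nat \<Rightarrow> int \<Rightarrow> int \<Rightarrow> 'm \<Rightarrow> 'm)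
       \<Rightarrow> nat \<Rightarrow> int \<Rightarrow> int \<Rightarrow> 'm set"
  where "boundaries C d r p b = {x \<in> carrier (C p b). \<exists>c.
    (\<forall>j\<in>{0..r - 1}. c (p + int j) \<in> carrier (C (p + int j) (b - int j + 1))) \<and>
    x = (\<Oplus>\<^bsub>C p b\<^esub>j\<in>{0..r - 1}. d j (p + int j) (b - int j + 1) (c (p + int j))) \<and>
    (\<forall>l\<in>{1..r - 1}. \<zero>\<^bsub>C (p + int l) (b - int l)\<^esub> =
       (\<Oplus>\<^bsub>C (p + int l) (b - int l)\<^esub>j\<in>{l..r - 1}.
          d (j - l) (p + int j) (b - int j + 1) (c (p + int j))))}"

definition page ::
    "(int \<Rightarrow> int \<Rightarrow> ('k, 'm, 'y) module_scheme) \<Rightarrow> (nat \<Rightarrow> int \<Rightarrow> int \<Rightarrow> 'm \<Rightarrow> 'm)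
       \<Rightarrow> nat \<Rightarrow> int \<Rightarrow> int \<Rightarrow> ('k, 'm set) module"
  where "page C d r p b = subquotient (C p b) (cycles C d r p b) (boundaries C d r p b)"

definition page_class ::
    "(int \<Rightarrow> int \<Rightarrow> ('k, 'm, 'y) module_scheme) \<Rightarrow> (nat \<Rightarrow> int \<Rightarrow> int \<Rightarrow> 'm \<Rightarrow> 'm)
       \<Rightarrow> nat \<Rightarrow> int \<Rightarrow> int \<Rightarrow> 'm \<Rightarrow> 'm set"
  where "page_class C d r p b x = boundaries C d r p b +>\<^bsub>C p b\<^esub> x"

text \<open>\<open>\<psi>\<close> in filtration degree \<open>q\<close> and total degree \<open>n\<close>.\<close>

definition psi ::
    "(int \<Rightarrow> int \<Rightarrow> ('k, 'm, 'y) module_scheme) \<Rightarrow> (nat \<Rightarrow> int \<Rightarrow> int \<Rightarrow> 'm \<Rightarrow> 'm)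
       \<Rightarrow> nat \<Rightarrow> int \<Rightarrow> int \<Rightarrow> (int \<Rightarrow> 'm) set \<Rightarrow> 'm set"
  where "psi C d r q n X = the_elem ((\<lambda>x. page_class C d r q (n - q) (x q)) ` X)"

definition Delta_rep ::
    "(int \<Rightarrow> int \<Rightarrow> ('k, 'm, 'y) module_scheme) \<Rightarrow> (nat \<Rightarrow> int \<Rightarrow> int \<Rightarrow> 'm \<Rightarrow> 'm)
       \<Rightarrow> nat \<Rightarrow> int \<Rightarrow> int \<Rightarrow> 'm \<Rightarrow> (int \<Rightarrow> 'm) \<Rightarrow> 'm"
  where "Delta_rep C d r p b x z =
    d r p b x \<ominus>\<^bsub>C (p - int r) (b + int r - 1)\<^esub>
      (\<Oplus>\<^bsub>C (p - int r) (b + int r - 1)\<^esub>i\<in>{1..r - 1}.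
         d i (p - int r + int i) (b + int r - int i) (z (p - int r + int i)))"

definition Delta ::
    "(int \<Rightarrow> int \<Rightarrow> ('k, 'm, 'y) module_scheme) \<Rightarrow> (nat \<Rightarrow> int \<Rightarrow> int \<Rightarrow> 'm \<Rightarrow> 'm)
       \<Rightarrow> nat \<Rightarrow> int \<Rightarrow> int \<Rightarrow> 'm set \<Rightarrow> 'm set"
  where "Delta C d r p b X =
    the_elem {page_class C d r (p - int r) (b + int r - 1) (Delta_rep C d r p b x z) | x z.
                x \<in> X \<and> zigzag C d r p b x z}"

end

theory Submission
  imports Defs
begin

text \<open>
  A zigzag \<open>(x, z)\<close> assembles to the element \<open>w = x - \<Sum>\<^sub>j z (p - j)\<close> of \<open>F\<^sub>p D\<close>. The zigzag
  equations say precisely that the components of \<open>d w\<close> in degrees above \<open>p - r\<close> vanish, and the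
  component in degree \<open>p - r\<close> is then the representative of \<open>\<Delta>\<^sub>r [x]\<close>. Likewise the equations
  for boundaries say that \<open>x\<close> is the leading component of \<open>d c\<close> for some \<open>c\<close> in \<open>F\<^sub>p\<^sub>+\<^sub>r\<^sub>-\<^sub>1 D\<close> with
  \<open>d c\<close> in \<open>F\<^sub>p D\<close>. Hence \<open>\<psi>\<close> and \<open>\<delta>\<^sub>r\<close> are both induced by linear maps on subquotients, and \<open>\<Delta>\<^sub>r\<close> is
  well defined because \<open>\<psi>\<close> is injective.
\<close>

section \<open>Linear maps and subquotients\<close>

text \<open>\<open>psi\<close>, \<open>page_diff\<close> and \<open>Delta\<close> are each given by
  \<open>the_elem\<close> of a set of classes, so nothing is known about a value until that set is a
  singleton. For the first two this is independence of the coset representative. For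
  \<open>Delta\<close> the set ranges over every member x of the class and over every zigzag that
  starts at x; comparing two choices directly would require writing the difference of their
  representatives as a boundary. Lifting each choice to the total complex avoids this: injectivity
  of \<open>psi\<close> fixes the class of the lift, so well-definedness, the explicit formula and
  compatibility with the differential come out of a single argument, and linearity of
  \<open>Delta\<close> is transported along \<open>psi\<close>. The other obstacle is that the
  differential sums over the support of its argument, which varies, while the components live in
  different modules. Since every element of the total complex lies in some filtration step, all sums
  can be rewritten over a common finite range that depends only on a bound for the degree.\<close>

lemma linear_mapsD:
  assumes "f \<in> linear_maps R M N"
  shows "x \<in> carrier M \<Longrightarrow> f x \<in> carrier N"
    and "x \<in> carrier M \<Longrightarrow> y \<in> carrier M \<Longrightarrow> f (x \<oplus>\<^bsub>M\<^esub> y) = f x \<oplus>\<^bsub>N\<^esub> f y"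
    and "s \<in> carrier R \<Longrightarrow> x \<in> carrier M \<Longrightarrow> f (s \<odot>\<^bsub>M\<^esub> x) = s \<odot>\<^bsub>N\<^esub> f x"
  using assms by (auto simp: linear_maps_def)

text \<open>Supplies the facts on zero and additive inverses that \<open>linear_maps\<close> does
  not list.\<close>

lemma linear_map_abelian_group_hom:
  assumes "module R M" "module R N" "f \<in> linear_maps R M N"
  shows "abelian_group_hom M N f"
proof -
  interpret M: module R M by fact
  interpret N: module R N by fact
  show ?thesis
    by (intro abelian_group_homI M.abelian_group_axioms N.abelian_group_axioms group_hom.intro
        M.a_group N.a_group group_hom_axioms.intro homI)
       (auto simp: linear_mapsD[OF assms(3)])
qed

lemma (in abelian_group_hom) hom_finsum:
  "g \<in> S \<rightarrow> carrier G \<Longrightarrow> h (finsum G g S) = finsum H (\<lambda>i. h (g i)) S"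
proof (induction S rule: infinite_finite_induct)
  case (insert i S)
  then show ?case
    by (subst G.finsum_insert; (subst H.finsum_insert)?) (auto simp: Pi_def)
qed auto

text \<open>Both sides sum \<open>g\<close> over the triangle i + j \<le> N, by rows and by
  antidiagonals. Raising N by one adds the antidiagonal i + j = N + 1 on either side. In the proof
  of d d = 0 the antidiagonal sums are the multicomplex relations.\<close>

lemma (in abelian_monoid) finsum_triangle:
  assumes "\<And>i j. i + j \<le> N \<Longrightarrow> g i j \<in> carrier G"
  shows "finsum G (\<lambda>i. finsum G (g i) {..N - i}) {..N::nat}
    = finsum G (\<lambda>m. finsum G (\<lambda>i. g i (m - i)) {..m}) {..N}"
  using assms
proof (induction N)
  case 0
  then show ?case by simp
next
  case (Suc N)
  have g: "g i j \<in> carrier G" if "i + j \<le> Suc N" for i j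
    using Suc.prems that by blast
  have "finsum G (\<lambda>i. finsum G (g i) {..Suc N - i}) {..Suc N}
      = g (Suc N) 0 \<oplus> finsum G (\<lambda>i. finsum G (g i) {..Suc N - i}) {..N}"
    using g by (subst finsum_Suc) (auto intro!: finsum_closed)
  \<comment> \<open>Each row i \<le> N gives up its last entry, which lies on the new antidiagonal;
    \<open>g (Suc N) 0\<close> completes that antidiagonal.\<close>
  also have "finsum G (\<lambda>i. finsum G (g i) {..Suc N - i}) {..N}
      = finsum G (\<lambda>i. g i (Suc N - i) \<oplus> finsum G (g i) {..N - i}) {..N}"
    using g by (intro finsum_cong') (auto intro!: finsum_closed a_closed simp: Suc_diff_le)
  also have "\<dots> = finsum G (\<lambda>i. g i (Suc N - i)) {..N} \<oplus> finsum G (\<lambda>i. finsum G (g i) {..N - i}) {..N}"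
    using g by (intro finsum_addf) (auto intro!: finsum_closed)
  also have "finsum G (\<lambda>i. finsum G (g i) {..N - i}) {..N}
      = finsum G (\<lambda>m. finsum G (\<lambda>i. g i (m - i)) {..m}) {..N}"
    using g by (intro Suc.IH) auto
  also have "g (Suc N) 0 \<oplus> (finsum G (\<lambda>i. g i (Suc N - i)) {..N} \<oplus> \<dots>)
      = finsum G (\<lambda>i. g i (Suc N - i)) {..Suc N} \<oplus> \<dots>"
    using g by (subst finsum_Suc) (auto intro!: finsum_closed simp: a_assoc)
  also have "\<dots> = finsum G (\<lambda>m. finsum G (\<lambda>i. g i (m - i)) {..m}) {..Suc N}"
    using g by (subst (2) finsum_Suc) (auto intro!: finsum_closed)
  finally show ?case .
qed

lemma (in abelian_group) finsum_uminus:
  "f \<in> A \<rightarrow> carrier G \<Longrightarrow> (\<Oplus>i\<in>A. \<ominus> f i) = \<ominus> finsum G f A"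
proof -
  have zero: "\<ominus> \<zero> = \<zero>"
    by (rule minus_equality) simp_all
  show "f \<in> A \<rightarrow> carrier G \<Longrightarrow> (\<Oplus>i\<in>A. \<ominus> f i) = \<ominus> finsum G f A"
  proof (induction A rule: infinite_finite_induct)
    case (insert i A)
    then have "f i \<in> carrier G" "finsum G f A \<in> carrier G" "(\<lambda>i. \<ominus> f i) \<in> A \<rightarrow> carrier G"
      by auto
    then show ?case
      using insert by (simp add: minus_add)
  qed (simp_all add: zero)
qed

lemma (in abelian_group) minus_eq_zero_iff:
  "x \<in> carrier G \<Longrightarrow> y \<in> carrier G \<Longrightarrow> x \<ominus> y = \<zero> \<longleftrightarrow> x = y"
  by (metis a_minus_def add.inv_closed local.minus_equality minus_minus r_neg)

section \<open>Submodules and their cosets\<close>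

context module
begin

text \<open>Negation is multiplication by the scalar -1, so closure under it follows from
  \<open>smult\<close>.\<close>

lemma submoduleI_smult:
  assumes subset: "H \<subseteq> carrier M" and zero: "\<zero>\<^bsub>M\<^esub> \<in> H"
    and add: "\<And>x y. x \<in> H \<Longrightarrow> y \<in> H \<Longrightarrow> x \<oplus>\<^bsub>M\<^esub> y \<in> H"
    and smult: "\<And>s x. s \<in> carrier R \<Longrightarrow> x \<in> H \<Longrightarrow> s \<odot>\<^bsub>M\<^esub> x \<in> H"
  shows "submodule H R M"
proof (rule submoduleI[OF subset zero _ add smult])
  fix x assume x: "x \<in> H"
  then have "\<ominus>\<^bsub>M\<^esub> x = (\<ominus> \<one>) \<odot>\<^bsub>M\<^esub> x"
    using subset smult_l_minus[of \<one> x] by auto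
  then show "\<ominus>\<^bsub>M\<^esub> x \<in> H"
    using smult[OF _ x] by simp
qed

lemma submodule_mem:
  assumes "submodule H R M"
  shows "x \<in> H \<Longrightarrow> x \<in> carrier M" "\<zero>\<^bsub>M\<^esub> \<in> H"
    "x \<in> H \<Longrightarrow> y \<in> H \<Longrightarrow> x \<oplus>\<^bsub>M\<^esub> y \<in> H" "x \<in> H \<Longrightarrow> y \<in> H \<Longrightarrow> x \<ominus>\<^bsub>M\<^esub> y \<in> H"
    "s \<in> carrier R \<Longrightarrow> x \<in> H \<Longrightarrow> s \<odot>\<^bsub>M\<^esub> x \<in> H"
proof -
  interpret submodule H R M by fact
  show "x \<in> H \<Longrightarrow> x \<in> carrier M" "\<zero>\<^bsub>M\<^esub> \<in> H"
    "x \<in> H \<Longrightarrow> y \<in> H \<Longrightarrow> x \<oplus>\<^bsub>M\<^esub> y \<in> H" "s \<in> carrier R \<Longrightarrow> x \<in> H \<Longrightarrow> s \<odot>\<^bsub>M\<^esub> x \<in> H"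
    using submoduleE[OF assms] one_closed by auto
  show "x \<in> H \<Longrightarrow> y \<in> H \<Longrightarrow> x \<ominus>\<^bsub>M\<^esub> y \<in> H"
    using submoduleE[OF assms] by (auto simp: a_minus_def)
qed

lemma abelian_subgroup_submodule:
  "submodule B R M \<Longrightarrow> abelian_subgroup B M"
  by (intro abelian_subgroupI3 additive_subgroupI submodule.axioms(1) M.abelian_group_axioms)

lemma submodule_coset_mem_iff:
  assumes "submodule B R M" "x \<in> carrier M"
  shows "y \<in> B +>\<^bsub>M\<^esub> x \<longleftrightarrow> y \<in> carrier M \<and> y \<ominus>\<^bsub>M\<^esub> x \<in> B"
proof -
  interpret abelian_subgroup B M
    using assms(1) by (rule abelian_subgroup_submodule)
  show ?thesis
    using a_rcos_module[OF assms(2)] a_elemrcos_carrier[OF assms(2)] unfolding a_minus_def by blast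
qed

lemma submodule_coset_eq_iff:
  assumes "submodule B R M" "x \<in> carrier M" "y \<in> carrier M"
  shows "B +>\<^bsub>M\<^esub> x = B +>\<^bsub>M\<^esub> y \<longleftrightarrow> x \<ominus>\<^bsub>M\<^esub> y \<in> B"
proof -
  interpret abelian_subgroup B M
    using assms(1) by (rule abelian_subgroup_submodule)
  show ?thesis
    using assms a_rcos_self[of x] a_repr_independence'[of x y] submodule_coset_mem_iff[OF assms(1,3)]
    by auto
qed

lemma submodule_coset_add:
  assumes "submodule B R M" "x \<in> carrier M" "y \<in> carrier M"
  shows "(B +>\<^bsub>M\<^esub> x) <+>\<^bsub>M\<^esub> (B +>\<^bsub>M\<^esub> y) = B +>\<^bsub>M\<^esub> (x \<oplus>\<^bsub>M\<^esub> y)"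
proof -
  interpret abelian_subgroup B M
    using assms(1) by (rule abelian_subgroup_submodule)
  show ?thesis
    using assms a_rcos_sum by simp
qed

text \<open>All members of the union are the same coset, because s y - s x = s (y - x) lies in
  \<open>B\<close>; the union is nonempty because x lies in its own coset.\<close>

lemma submodule_coset_smult:
  assumes B: "submodule B R M" and s: "s \<in> carrier R" and x: "x \<in> carrier M"
  shows "(\<Union>y\<in>B +>\<^bsub>M\<^esub> x. B +>\<^bsub>M\<^esub> (s \<odot>\<^bsub>M\<^esub> y)) = B +>\<^bsub>M\<^esub> (s \<odot>\<^bsub>M\<^esub> x)"
proof -
  interpret abelian_subgroup B M
    using B by (rule abelian_subgroup_submodule)
  have "B +>\<^bsub>M\<^esub> (s \<odot>\<^bsub>M\<^esub> y) = B +>\<^bsub>M\<^esub> (s \<odot>\<^bsub>M\<^esub> x)" if "y \<in> B +>\<^bsub>M\<^esub> x" for y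
  proof -
    have y: "y \<in> carrier M" "y \<ominus>\<^bsub>M\<^esub> x \<in> B"
      using that submodule_coset_mem_iff[OF B x] by auto
    have "s \<odot>\<^bsub>M\<^esub> y \<ominus>\<^bsub>M\<^esub> s \<odot>\<^bsub>M\<^esub> x = s \<odot>\<^bsub>M\<^esub> (y \<ominus>\<^bsub>M\<^esub> x)"
      using s x y(1) by (simp add: a_minus_def smult_r_distr smult_r_minus)
    then show ?thesis
      using submodule_mem(5)[OF B s y(2)] s x y(1) by (simp add: submodule_coset_eq_iff[OF B])
  qed
  then show ?thesis
    using a_rcos_self[OF x] by blast
qed

lemma submodule_set_add:
  assumes "submodule H R M" "submodule K R M"
  shows "submodule (H <+>\<^bsub>M\<^esub> K) R M"
proof (intro submodule.intro submodule_axioms.intro)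
  show "subgroup (H <+>\<^bsub>M\<^esub> K) (add_monoid M)"
    using add_additive_subgroups assms additive_subgroup_def submodule.axioms(1) by blast
next
  fix s x assume "s \<in> carrier R" "x \<in> H <+>\<^bsub>M\<^esub> K"
  then obtain h k where hk: "h \<in> H" "k \<in> K" "x = h \<oplus>\<^bsub>M\<^esub> k" and s: "s \<in> carrier R"
    by (auto simp: set_add_def')
  have "s \<odot>\<^bsub>M\<^esub> x = s \<odot>\<^bsub>M\<^esub> h \<oplus>\<^bsub>M\<^esub> s \<odot>\<^bsub>M\<^esub> k"
    using hk s submodule_mem(1)[OF assms(1)] submodule_mem(1)[OF assms(2)] by (simp add: smult_r_distr)
  then show "s \<odot>\<^bsub>M\<^esub> x \<in> H <+>\<^bsub>M\<^esub> K"
    using submodule_mem(5)[OF assms(1) s hk(1)] submodule_mem(5)[OF assms(2) s hk(2)]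
    by (auto simp: set_add_def')
qed

end

lemma linear_map_submodule_image:
  assumes "module R M" "module R N" "f \<in> linear_maps R M N" "submodule H R M"
  shows "submodule (f ` H) R N"
proof -
  interpret M: module R M by fact
  interpret N: module R N by fact
  interpret abelian_group_hom M N f
    using assms(1-3) by (rule linear_map_abelian_group_hom)
  note H = M.submodule_mem[OF assms(4)] M.submoduleE(3)[OF assms(4)]
  show ?thesis
  proof (rule N.submoduleI)
    show "\<zero>\<^bsub>N\<^esub> \<in> f ` H" using H(2) hom_zero by (metis imageI)
    show "\<ominus>\<^bsub>N\<^esub> a \<in> f ` H" if a: "a \<in> f ` H" for a
    proof -
      obtain x where x: "x \<in> H" "a = f x" using a by blast
      have "\<ominus>\<^bsub>N\<^esub> a = f (\<ominus>\<^bsub>M\<^esub> x)" using x H(1) by simp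
      then show ?thesis using x H(6) by simp
    qed
    show "a \<oplus>\<^bsub>N\<^esub> b \<in> f ` H" if a: "a \<in> f ` H" and b: "b \<in> f ` H" for a b
    proof -
      obtain x y where x: "x \<in> H" "a = f x" "y \<in> H" "b = f y" using a b by blast
      have "a \<oplus>\<^bsub>N\<^esub> b = f (x \<oplus>\<^bsub>M\<^esub> y)" using x H(1) by simp
      then show ?thesis using x H(3) by simp
    qed
    show "s \<odot>\<^bsub>N\<^esub> a \<in> f ` H" if s: "s \<in> carrier R" and a: "a \<in> f ` H" for s a
    proof -
      obtain x where x: "x \<in> H" "a = f x" using a by blast
      have "s \<odot>\<^bsub>N\<^esub> a = f (s \<odot>\<^bsub>M\<^esub> x)" using x s H(1) linear_mapsD(3)[OF assms(3)] by simp
      then show ?thesis using x s H(5) by simp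
    qed
  qed (use H in auto)
qed

text \<open>With the total differential for \<open>f\<close> and filtration steps for
  \<open>H\<close> and \<open>K\<close> this is the shape of \<open>cycles_tot\<close>.\<close>

lemma linear_map_submodule_vimage:
  assumes "module R M" "module R N" "f \<in> linear_maps R M N" "submodule H R M" "submodule K R N"
  shows "submodule {x \<in> H. f x \<in> K} R M"
proof -
  interpret M: module R M by fact
  interpret N: module R N by fact
  interpret abelian_group_hom M N f
    using assms(1-3) by (rule linear_map_abelian_group_hom)
  note H = M.submodule_mem[OF assms(4)] M.submoduleE(3)[OF assms(4)]
  note K = N.submodule_mem[OF assms(5)] N.submoduleE(3)[OF assms(5)]
  show ?thesis
    by (rule M.submoduleI) (use H K linear_mapsD(3)[OF assms(3)] in auto)
qed

text \<open>Together with \<open>subquotient_smult_closed\<close> this is all that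
  \<open>linear_maps_factor_iso\<close> asks of its domain, so the module axioms of a subquotient
  are never verified.\<close>

lemma subquotient_add_closed:
  assumes "module R M" "submodule Z R M" "submodule B R M"
    "X \<in> carrier (subquotient M Z B)" "Y \<in> carrier (subquotient M Z B)"
  shows "X \<oplus>\<^bsub>subquotient M Z B\<^esub> Y \<in> carrier (subquotient M Z B)"
proof -
  interpret M: module R M by fact
  show ?thesis
    using assms(4,5) M.submodule_mem[OF assms(2)] M.submodule_coset_add[OF assms(3)]
    by (auto simp: subquotient_def)
qed

lemma subquotient_smult_closed:
  assumes "module R M" "submodule Z R M" "submodule B R M"
    "s \<in> carrier R" "X \<in> carrier (subquotient M Z B)"
  shows "s \<odot>\<^bsub>subquotient M Z B\<^esub> X \<in> carrier (subquotient M Z B)"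
proof -
  interpret M: module R M by fact
  show ?thesis
    using assms(4,5) M.submodule_mem[OF assms(2)] M.submodule_coset_smult[OF assms(3,4)]
    by (auto simp: subquotient_def)
qed

lemma linear_maps_comp:
  assumes "f \<in> linear_maps R M N" "g \<in> linear_maps R N P"
  shows "(\<lambda>x. g (f x)) \<in> linear_maps R M P"
  using assms by (auto simp: linear_maps_def Pi_iff)

text \<open>Every element of \<open>N\<close> is some \<open>g x\<close>, and sums and multiples of
  such elements are again values of \<open>g\<close>, so \<open>k\<close> inherits linearity from
  \<open>h\<close>. It serves to make \<open>Delta\<close> linear, with \<open>psi\<close> as
  \<open>g\<close> and \<open>psi\<close> after \<open>page_diff\<close> as
  \<open>h\<close>.\<close>

lemma linear_maps_factor_iso:
  assumes g: "g \<in> linear_isos R M N" and h: "h \<in> linear_maps R M P"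
    and add: "\<And>x y. x \<in> carrier M \<Longrightarrow> y \<in> carrier M \<Longrightarrow> x \<oplus>\<^bsub>M\<^esub> y \<in> carrier M"
    and smult: "\<And>s x. s \<in> carrier R \<Longrightarrow> x \<in> carrier M \<Longrightarrow> s \<odot>\<^bsub>M\<^esub> x \<in> carrier M"
    and k: "\<And>x. x \<in> carrier M \<Longrightarrow> k (g x) = h x"
  shows "k \<in> linear_maps R N P"
proof -
  have g': "g \<in> linear_maps R M N" and N: "carrier N = g ` carrier M"
    using g by (auto simp: linear_isos_def bij_betw_def)
  show ?thesis
    unfolding linear_maps_def N
    using add smult k by (auto simp flip: linear_mapsD(2,3)[OF g'] simp: linear_mapsD[OF h])
qed

section \<open>Maps induced between subquotients\<close>

locale subquotient_map =
  fixes R :: "('k, 'x) ring_scheme"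
    and M :: "('k, 'm, 'y) module_scheme" and N :: "('k, 'n, 'z) module_scheme"
    and f :: "'m \<Rightarrow> 'n" and Z B :: "'m set" and Z' B' :: "'n set"
  assumes M: "module R M" and N: "module R N" and f: "f \<in> linear_maps R M N"
    and Z: "submodule Z R M" and B: "submodule B R M"
    and Z': "submodule Z' R N" and B': "submodule B' R N"
    and B_subset: "B \<subseteq> Z" and f_Z: "\<And>x. x \<in> Z \<Longrightarrow> f x \<in> Z'" and f_B: "\<And>x. x \<in> B \<Longrightarrow> f x \<in> B'"
begin

text \<open>Has the same \<open>the_elem\<close> shape as \<open>psi\<close> and
  \<open>page_diff\<close>, which unfold to it with the projection to component p and the total
  differential as \<open>f\<close>.\<close>

definition induced :: "'m set \<Rightarrow> 'n set"
  where "induced X = the_elem ((\<lambda>x. B' +>\<^bsub>N\<^esub> f x) ` X)"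

interpretation M: module R M by (rule M)
interpretation N: module R N by (rule N)
interpretation abelian_group_hom M N f using M N f by (rule linear_map_abelian_group_hom)
interpretation B: abelian_subgroup B M using B by (rule M.abelian_subgroup_submodule)

text \<open>Members of one coset of \<open>B\<close> differ by an element of \<open>B\<close>, which
  \<open>f\<close> sends into \<open>B'\<close>; the set under \<open>the_elem\<close> is therefore
  a singleton.\<close>

lemma induced_coset:
  assumes "x \<in> Z"
  shows "induced (B +>\<^bsub>M\<^esub> x) = B' +>\<^bsub>N\<^esub> f x"
proof -
  have x: "x \<in> carrier M"
    using assms M.submodule_mem[OF Z] by blast
  have "B' +>\<^bsub>N\<^esub> f y = B' +>\<^bsub>N\<^esub> f x" if "y \<in> B +>\<^bsub>M\<^esub> x" for y
  proof -
    have y: "y \<in> carrier M" "y \<ominus>\<^bsub>M\<^esub> x \<in> B"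
      using that M.submodule_coset_mem_iff[OF B x] by auto
    have "f (y \<ominus>\<^bsub>M\<^esub> x) = f y \<ominus>\<^bsub>N\<^esub> f x"
      using x y by (simp add: a_minus_def)
    then show ?thesis
      using x y f_B[OF y(2)] by (simp add: N.submodule_coset_eq_iff[OF B'])
  qed
  then have "(\<lambda>y. B' +>\<^bsub>N\<^esub> f y) ` (B +>\<^bsub>M\<^esub> x) = {B' +>\<^bsub>N\<^esub> f x}"
    using B.a_rcos_self[OF x] by blast
  then show ?thesis
    by (simp add: induced_def)
qed

lemma induced_linear: "induced \<in> linear_maps R (subquotient M Z B) (subquotient N Z' B')"
proof -
  note Z_mem = M.submodule_mem[OF Z]
  have "induced (X \<oplus>\<^bsub>subquotient M Z B\<^esub> Y)
      = induced X \<oplus>\<^bsub>subquotient N Z' B'\<^esub> induced Y"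
    if "X \<in> carrier (subquotient M Z B)" "Y \<in> carrier (subquotient M Z B)" for X Y
  proof -
    obtain x y where "x \<in> Z" "X = B +>\<^bsub>M\<^esub> x" "y \<in> Z" "Y = B +>\<^bsub>M\<^esub> y"
      using \<open>X \<in> _\<close> \<open>Y \<in> _\<close> by (auto simp: subquotient_def)
    then show ?thesis
      using Z_mem(1)[of x] Z_mem(1)[of y] Z_mem(3)[of x y]
      by (simp add: subquotient_def M.submodule_coset_add[OF B] N.submodule_coset_add[OF B'] induced_coset)
  qed
  moreover have "induced (s \<odot>\<^bsub>subquotient M Z B\<^esub> X) = s \<odot>\<^bsub>subquotient N Z' B'\<^esub> induced X"
    if s: "s \<in> carrier R" and "X \<in> carrier (subquotient M Z B)" for s X
  proof -
    obtain x where "x \<in> Z" "X = B +>\<^bsub>M\<^esub> x"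
      using \<open>X \<in> _\<close> by (auto simp: subquotient_def)
    then show ?thesis
      using s Z_mem(1)[of x] Z_mem(5)[of s x]
      by (simp add: subquotient_def M.submodule_coset_smult[OF B s]
          N.submodule_coset_smult[OF B' s] induced_coset linear_mapsD(3)[OF f])
  qed
  moreover have "induced \<in> carrier (subquotient M Z B) \<rightarrow> carrier (subquotient N Z' B')"
    using f_Z by (auto simp: subquotient_def induced_coset)
  ultimately show ?thesis
    by (simp add: linear_maps_def)
qed

text \<open>Applied to a difference x - y, \<open>inj\<close> turns equality of the image cosets
  into equality of the cosets themselves.\<close>

lemma induced_iso:
  assumes inj: "\<And>x. x \<in> Z \<Longrightarrow> f x \<in> B' \<Longrightarrow> x \<in> B" and surj: "\<And>y. y \<in> Z' \<Longrightarrow> \<exists>x\<in>Z. f x = y"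
  shows "induced \<in> linear_isos R (subquotient M Z B) (subquotient N Z' B')"
proof -
  note Z_mem = M.submodule_mem[OF Z]
  have "x \<ominus>\<^bsub>M\<^esub> y \<in> B" if "x \<in> Z" "y \<in> Z" "f x \<ominus>\<^bsub>N\<^esub> f y \<in> B'" for x y
  proof (rule inj)
    show "x \<ominus>\<^bsub>M\<^esub> y \<in> Z"
      by (rule Z_mem(4)[OF that(1,2)])
    have "f (x \<ominus>\<^bsub>M\<^esub> y) = f x \<ominus>\<^bsub>N\<^esub> f y"
      using Z_mem(1)[OF that(1)] Z_mem(1)[OF that(2)] by (simp add: a_minus_def)
    then show "f (x \<ominus>\<^bsub>M\<^esub> y) \<in> B'"
      using that by simp
  qed
  then have "inj_on induced (carrier (subquotient M Z B))"
    using Z_mem(1) unfolding inj_on_def subquotient_def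
    by (simp add: induced_coset M.submodule_coset_eq_iff[OF B] N.submodule_coset_eq_iff[OF B'])
  moreover have "induced ` carrier (subquotient M Z B) = carrier (subquotient N Z' B')"
  proof -
    have "Z' = f ` Z"
      using f_Z surj by (metis image_eqI image_subsetI subsetI subset_antisym)
    moreover have "induced ` (\<lambda>x. B +>\<^bsub>M\<^esub> x) ` Z = (\<lambda>x. B' +>\<^bsub>N\<^esub> f x) ` Z"
      unfolding image_image by (rule image_cong) (simp_all add: induced_coset)
    ultimately show ?thesis
      by (simp add: subquotient_def image_image)
  qed
  ultimately show ?thesis
    using induced_linear by (simp add: linear_isos_def bij_betw_def)
qed

end

section \<open>The total complex of a multicomplex\<close>

context multicomplex
begin

interpretation C: module R "C a b" for a b
  by (rule component_module)

text \<open>The target indices are variables tied by equations because one bidegree arises in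
  several forms, such as \<open>n - 1 - a\<close> and \<open>b + int i - 1\<close>, that do not
  unify; each use leaves only integer arithmetic.\<close>

lemma d_linear:
  assumes "a' = a - int i" "b' = b + int i - 1"
  shows "d i a b \<in> linear_maps R (C a b) (C a' b')"
  using structure_map_linear[of i a b] assms by simp

lemma d_hom:
  assumes "a' = a - int i" "b' = b + int i - 1"
  shows "abelian_group_hom (C a b) (C a' b') (d i a b)"
  using component_module component_module d_linear[OF assms] by (rule linear_map_abelian_group_hom)

lemma d_closed:
  assumes "x \<in> carrier (C a b)" "a' = a - int i" "b' = b + int i - 1"
  shows "d i a b x \<in> carrier (C a' b')"
  using linear_mapsD(1)[OF d_linear[OF assms(2,3)] assms(1)] .

lemma d_zero:
  assumes "a' = a - int i" "b' = b + int i - 1"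
  shows "d i a b \<zero>\<^bsub>C a b\<^esub> = \<zero>\<^bsub>C a' b'\<^esub>"
  using abelian_group_hom.hom_zero[OF d_hom[OF assms]] .

section \<open>The module structure of the total complex\<close>

lemma Tot_sel:
  "carrier (Tot C n) = {x. (\<forall>a. x a \<in> carrier (C a (n - a))) \<and>
                   finite {a. a > 0 \<and> x a \<noteq> \<zero>\<^bsub>C a (n - a)\<^esub>}}"
  "\<zero>\<^bsub>Tot C n\<^esub> = (\<lambda>a. \<zero>\<^bsub>C a (n - a)\<^esub>)"
  "x \<oplus>\<^bsub>Tot C n\<^esub> y = (\<lambda>a. x a \<oplus>\<^bsub>C a (n - a)\<^esub> y a)"
  "s \<odot>\<^bsub>Tot C n\<^esub> x = (\<lambda>a. s \<odot>\<^bsub>C a (n - a)\<^esub> x a)"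
  by (simp_all add: Tot_def)

lemma Tot_carrierD: "x \<in> carrier (Tot C n) \<Longrightarrow> x a \<in> carrier (C a (n - a))"
  by (simp add: Tot_sel)

text \<open>Finiteness of the positive support comes for free: it is contained in the interval from
  1 to p.\<close>

lemma Tot_filtI:
  assumes "\<And>a. x a \<in> carrier (C a (n - a))" "\<And>a. p < a \<Longrightarrow> x a = \<zero>\<^bsub>C a (n - a)\<^esub>"
  shows "x \<in> Tot_filt C p n"
proof -
  have "{a. a > 0 \<and> x a \<noteq> \<zero>\<^bsub>C a (n - a)\<^esub>} \<subseteq> {0<..p}"
    using assms(2) by force
  then show ?thesis
    using assms finite_subset[OF _ finite_greaterThanAtMost_int] by (auto simp: Tot_filt_def Tot_sel)
qed

lemma Tot_filtD:
  assumes "x \<in> Tot_filt C p n"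
  shows "x \<in> carrier (Tot C n)" "x a \<in> carrier (C a (n - a))" "p < a \<Longrightarrow> x a = \<zero>\<^bsub>C a (n - a)\<^esub>"
  using assms by (auto simp: Tot_filt_def Tot_sel)

lemma Tot_filt_mono: "p \<le> q \<Longrightarrow> x \<in> Tot_filt C p n \<Longrightarrow> x \<in> Tot_filt C q n"
  by (auto simp: Tot_filt_def)

lemma Tot_bounded:
  assumes "x \<in> carrier (Tot C n)"
  obtains p where "x \<in> Tot_filt C p n"
proof -
  \<comment> \<open>Inserting 0 makes the set nonempty and its maximum nonnegative, so any degree
    above the maximum is positive and outside the support.\<close>
  define S where "S = insert 0 {a. a > 0 \<and> x a \<noteq> \<zero>\<^bsub>C a (n - a)\<^esub>}"
  have "finite S"
    using assms by (simp add: S_def Tot_sel)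
  have "x a = \<zero>\<^bsub>C a (n - a)\<^esub>" if "Max S < a" for a
  proof -
    have "a \<notin> S" "0 \<le> Max S"
      using Max_ge[OF \<open>finite S\<close>, of a] Max_ge[OF \<open>finite S\<close>, of 0] that by (auto simp: S_def)
    then show ?thesis
      using that by (simp add: S_def)
  qed
  then have "x \<in> Tot_filt C (Max S) n"
    using assms by (simp add: Tot_filt_def)
  then show ?thesis
    by (rule that)
qed

lemma Tot_common_bound:
  assumes "x \<in> carrier (Tot C n)" "y \<in> carrier (Tot C n)"
  obtains p where "x \<in> Tot_filt C p n" "y \<in> Tot_filt C p n"
proof -
  obtain p q where "x \<in> Tot_filt C p n" "y \<in> Tot_filt C q n"
    using Tot_bounded assms by metis
  then have "x \<in> Tot_filt C (max p q) n" "y \<in> Tot_filt C (max p q) n"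
    using Tot_filt_mono max.cobounded1 max.cobounded2 by blast+
  then show ?thesis
    by (rule that)
qed

text \<open>Sums and multiples stay below a common filtration degree, which yields finite support
  through \<open>Tot_filtI\<close>; inverses are multiples by -1.\<close>

lemma module_Tot: "module R (Tot C n)"
proof (rule moduleI[OF base_ring abelian_groupI])
  show add: "x \<oplus>\<^bsub>Tot C n\<^esub> y \<in> carrier (Tot C n)"
    if "x \<in> carrier (Tot C n)" "y \<in> carrier (Tot C n)" for x y
  proof -
    obtain p where "x \<in> Tot_filt C p n" "y \<in> Tot_filt C p n"
      using \<open>x \<in> _\<close> \<open>y \<in> _\<close> by (rule Tot_common_bound)
    then have "x \<oplus>\<^bsub>Tot C n\<^esub> y \<in> Tot_filt C p n"
      by (intro Tot_filtI) (auto simp: Tot_sel Tot_filtD)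
    then show ?thesis
      by (rule Tot_filtD)
  qed
  show smult: "s \<odot>\<^bsub>Tot C n\<^esub> x \<in> carrier (Tot C n)" if "s \<in> carrier R" "x \<in> carrier (Tot C n)" for s x
  proof -
    obtain p where "x \<in> Tot_filt C p n"
      using \<open>x \<in> _\<close> by (rule Tot_bounded)
    then have "s \<odot>\<^bsub>Tot C n\<^esub> x \<in> Tot_filt C p n"
      using \<open>s \<in> _\<close> by (intro Tot_filtI) (auto simp: Tot_sel Tot_filtD)
    then show ?thesis
      by (rule Tot_filtD)
  qed
  show "\<exists>y\<in>carrier (Tot C n). y \<oplus>\<^bsub>Tot C n\<^esub> x = \<zero>\<^bsub>Tot C n\<^esub>" if "x \<in> carrier (Tot C n)" for x
  proof (rule bexI[where x = "(\<ominus>\<^bsub>R\<^esub> \<one>\<^bsub>R\<^esub>) \<odot>\<^bsub>Tot C n\<^esub> x"])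
    show "(\<ominus>\<^bsub>R\<^esub> \<one>\<^bsub>R\<^esub>) \<odot>\<^bsub>Tot C n\<^esub> x \<oplus>\<^bsub>Tot C n\<^esub> x = \<zero>\<^bsub>Tot C n\<^esub>"
      using Tot_carrierD[OF that] by (simp add: Tot_sel C.smult_l_minus C.l_neg)
  qed (use smult that in simp)
qed (auto simp: Tot_sel C.a_ac C.smult_l_distr C.smult_r_distr C.smult_assoc1)

interpretation T: module R "Tot C n" for n
  by (rule module_Tot)

section \<open>Projections, filtration steps and the total differential\<close>

lemma proj_linear: "(\<lambda>x. x a) \<in> linear_maps R (Tot C n) (C a (n - a))"
  by (auto simp: linear_maps_def Tot_sel)

lemma Tot_filt_submodule: "submodule (Tot_filt C p n) R (Tot C n)"
proof (rule T.submoduleI_smult)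
  show "x \<oplus>\<^bsub>Tot C n\<^esub> y \<in> Tot_filt C p n" if "x \<in> Tot_filt C p n" "y \<in> Tot_filt C p n" for x y
    using that by (intro Tot_filtI) (auto simp: Tot_sel Tot_filtD)
  show "s \<odot>\<^bsub>Tot C n\<^esub> x \<in> Tot_filt C p n" if "s \<in> carrier R" "x \<in> Tot_filt C p n" for s x
    using that by (intro Tot_filtI) (auto simp: Tot_sel Tot_filtD)
qed (auto simp: Tot_filt_def Tot_sel)

text \<open>The definition sums over the exact support of x. Any larger finite index set gives the
  same value because each \<open>d i\<close> sends zero to zero, so different elements can be summed
  over one range.\<close>

lemma tot_diff_eq_finsum:
  assumes x: "x \<in> carrier (Tot C n)" and S: "finite S"
    and zero: "\<And>i. i \<notin> S \<Longrightarrow> x (a + int i) = \<zero>\<^bsub>C (a + int i) (n - (a + int i))\<^esub>"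
  shows "tot_diff C d n x a
    = (\<Oplus>\<^bsub>C a (n - 1 - a)\<^esub>i\<in>S. d i (a + int i) (n - (a + int i)) (x (a + int i)))"
  unfolding tot_diff_def
proof (rule C.M.add.finprod_mono_neutral_cong_left[OF S])
  fix i assume "i \<in> S - {i. x (a + int i) \<noteq> \<zero>\<^bsub>C (a + int i) (n - (a + int i))\<^esub>}"
  then show "d i (a + int i) (n - (a + int i)) (x (a + int i)) = \<zero>\<^bsub>C a (n - 1 - a)\<^esub>"
    using d_zero[of a "a + int i" i "n - 1 - a" "n - (a + int i)"] by simp
qed (use zero in \<open>auto intro!: d_closed Tot_carrierD[OF x]\<close>)

lemma tot_diff_eq_finsum_atMost:
  assumes x: "x \<in> Tot_filt C p n" and "p \<le> a + int N"
  shows "tot_diff C d n x a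
    = (\<Oplus>\<^bsub>C a (n - 1 - a)\<^esub>i\<in>{..N}. d i (a + int i) (n - (a + int i)) (x (a + int i)))"
proof (rule tot_diff_eq_finsum[OF Tot_filtD(1)[OF x]])
  fix i assume "i \<notin> {..N}"
  then show "x (a + int i) = \<zero>\<^bsub>C (a + int i) (n - (a + int i))\<^esub>"
    using assms(2) by (intro Tot_filtD(3)[OF x]) auto
qed simp

lemma tot_diff_Tot_filt:
  assumes x: "x \<in> Tot_filt C p n"
  shows "tot_diff C d n x \<in> Tot_filt C p (n - 1)"
proof (rule Tot_filtI)
  show "tot_diff C d n x a \<in> carrier (C a (n - 1 - a))" for a
    unfolding tot_diff_def
    by (rule C.M.finsum_closed) (auto intro!: d_closed Tot_filtD(2)[OF x])
  \<comment> \<open>All components of x in degrees a + i vanish here, so the empty index set is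
    admissible.\<close>
  show "tot_diff C d n x a = \<zero>\<^bsub>C a (n - 1 - a)\<^esub>" if "p < a" for a
    using that by (subst tot_diff_eq_finsum[OF Tot_filtD(1)[OF x], where S = "{}"]) (auto intro!: Tot_filtD(3)[OF x])
qed

lemma tot_diff_linear: "tot_diff C d n \<in> linear_maps R (Tot C n) (Tot C (n - 1))"
proof -
  have "tot_diff C d n x \<in> carrier (Tot C (n - 1))" if "x \<in> carrier (Tot C n)" for x
    using that Tot_bounded tot_diff_Tot_filt Tot_filtD(1) by metis
  moreover have "tot_diff C d n (x \<oplus>\<^bsub>Tot C n\<^esub> y) = tot_diff C d n x \<oplus>\<^bsub>Tot C (n - 1)\<^esub> tot_diff C d n y"
    if xy: "x \<in> carrier (Tot C n)" "y \<in> carrier (Tot C n)" for x y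
  proof (rule ext)
    fix a
    obtain p where p: "x \<in> Tot_filt C p n" "y \<in> Tot_filt C p n"
      using xy by (rule Tot_common_bound)
    then have xy: "x \<oplus>\<^bsub>Tot C n\<^esub> y \<in> Tot_filt C p n"
      using T.submodule_mem(3)[OF Tot_filt_submodule] by blast
    have N: "p \<le> a + int (nat (p - a))"
      by simp
    have "d i (a + int i) (n - (a + int i)) ((x \<oplus>\<^bsub>Tot C n\<^esub> y) (a + int i))
        = d i (a + int i) (n - (a + int i)) (x (a + int i))
          \<oplus>\<^bsub>C a (n - 1 - a)\<^esub> d i (a + int i) (n - (a + int i)) (y (a + int i))" for i
      using linear_mapsD(2)[OF d_linear[of a "a + int i" i "n - 1 - a" "n - (a + int i)"]] p
      by (simp add: Tot_sel Tot_filtD)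
    then show "tot_diff C d n (x \<oplus>\<^bsub>Tot C n\<^esub> y) a
        = (tot_diff C d n x \<oplus>\<^bsub>Tot C (n - 1)\<^esub> tot_diff C d n y) a"
      unfolding Tot_sel(3)[of "n - 1"] tot_diff_eq_finsum_atMost[OF p(1) N]
        tot_diff_eq_finsum_atMost[OF p(2) N] tot_diff_eq_finsum_atMost[OF xy N]
      by (subst C.M.finsum_addf[symmetric]) (auto intro!: d_closed Tot_filtD(2)[OF p(1)] Tot_filtD(2)[OF p(2)])
  qed
  moreover have "tot_diff C d n (s \<odot>\<^bsub>Tot C n\<^esub> x) = s \<odot>\<^bsub>Tot C (n - 1)\<^esub> tot_diff C d n x"
    if s: "s \<in> carrier R" and "x \<in> carrier (Tot C n)" for s x
  proof (rule ext)
    fix a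
    obtain p where p: "x \<in> Tot_filt C p n"
      using \<open>x \<in> _\<close> by (rule Tot_bounded)
    then have sx: "s \<odot>\<^bsub>Tot C n\<^esub> x \<in> Tot_filt C p n"
      using T.submodule_mem(5)[OF Tot_filt_submodule s] by blast
    have N: "p \<le> a + int (nat (p - a))"
      by simp
    have "d i (a + int i) (n - (a + int i)) ((s \<odot>\<^bsub>Tot C n\<^esub> x) (a + int i))
        = s \<odot>\<^bsub>C a (n - 1 - a)\<^esub> d i (a + int i) (n - (a + int i)) (x (a + int i))" for i
      using linear_mapsD(3)[OF d_linear[of a "a + int i" i "n - 1 - a" "n - (a + int i)"] s] p
      by (simp add: Tot_sel Tot_filtD)
    then show "tot_diff C d n (s \<odot>\<^bsub>Tot C n\<^esub> x) a = (s \<odot>\<^bsub>Tot C (n - 1)\<^esub> tot_diff C d n x) a"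
      unfolding Tot_sel(4)[of "n - 1"] tot_diff_eq_finsum_atMost[OF p N] tot_diff_eq_finsum_atMost[OF sx N]
      using s by (subst C.finsum_smult_ldistr) (auto intro!: d_closed Tot_filtD(2)[OF p])
  qed
  ultimately show ?thesis
    by (simp add: linear_maps_def)
qed

lemma tot_diff_tot_diff:
  assumes "x \<in> carrier (Tot C n)"
  shows "tot_diff C d (n - 1) (tot_diff C d n x) = \<zero>\<^bsub>Tot C (n - 2)\<^esub>"
proof (rule ext)
  fix a
  obtain p where p: "x \<in> Tot_filt C p n"
    using assms by (rule Tot_bounded)
  \<comment> \<open>Components of x above a + N vanish, so both applications of the differential
    become finite sums with bounds depending on N alone.\<close>
  define N where "N = nat (p - a)"
  define G where "G = C a (n - 2 - a)"
  interpret G: module R G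
    unfolding G_def by (rule component_module)
  define g where "g i j = d i (a + int i) (n - 1 - (a + int i))
      (d j (a + int i + int j) (n - (a + int i + int j)) (x (a + int i + int j)))" for i j
  have g: "g i j \<in> carrier G" for i j
    unfolding g_def G_def by (auto intro!: d_closed Tot_filtD(2)[OF p])
  have "tot_diff C d (n - 1) (tot_diff C d n x) a
      = (\<Oplus>\<^bsub>G\<^esub>i\<in>{..N}. d i (a + int i) (n - 1 - (a + int i)) (tot_diff C d n x (a + int i)))"
    using tot_diff_eq_finsum_atMost[OF tot_diff_Tot_filt[OF p], of a N]
    by (simp add: N_def G_def)
  \<comment> \<open>Once i is used up, only j \<le> N - i can contribute; this cuts the square of
    indices down to a triangle.\<close>
  also have "\<dots> = (\<Oplus>\<^bsub>G\<^esub>i\<in>{..N}. \<Oplus>\<^bsub>G\<^esub>j\<in>{..N - i}. g i j)"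
  proof (rule G.M.finsum_cong')
    fix i assume "i \<in> {..N}"
    then have "p \<le> a + int i + int (N - i)"
      by (auto simp: N_def)
    note eq = tot_diff_eq_finsum_atMost[OF p this]
    show "d i (a + int i) (n - 1 - (a + int i)) (tot_diff C d n x (a + int i))
        = (\<Oplus>\<^bsub>G\<^esub>j\<in>{..N - i}. g i j)"
      unfolding eq g_def G_def
      by (subst abelian_group_hom.hom_finsum[OF d_hom]) (auto intro!: d_closed Tot_filtD(2)[OF p])
  qed (use g in auto)
  also have "\<dots> = (\<Oplus>\<^bsub>G\<^esub>m\<in>{..N}. \<Oplus>\<^bsub>G\<^esub>i\<in>{..m}. g i (m - i))"
    by (rule G.M.finsum_triangle) (rule g)
  also have "\<dots> = (\<Oplus>\<^bsub>G\<^esub>m\<in>{..N}. \<zero>\<^bsub>G\<^esub>)"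
  proof (rule G.M.finsum_cong')
    fix m
    \<comment> \<open>Bidegrees are brought into the form of \<open>structure_relation\<close>;
      writing m = i + j removes the truncated subtraction.\<close>
    have "g i (m - i) = d i (a + int m - int (m - i)) (n - (a + int m) + int (m - i) - 1)
        (d (m - i) (a + int m) (n - (a + int m)) (x (a + int m)))" if im: "i \<le> m" for i
    proof -
      obtain j where "m = i + j"
        using im le_Suc_ex by blast
      then show ?thesis
        by (simp add: g_def algebra_simps)
    qed
    then have "(\<Oplus>\<^bsub>G\<^esub>i\<in>{..m}. d i (a + int m - int (m - i)) (n - (a + int m) + int (m - i) - 1)
        (d (m - i) (a + int m) (n - (a + int m)) (x (a + int m)))) = (\<Oplus>\<^bsub>G\<^esub>i\<in>{..m}. g i (m - i))"
      by (intro G.M.finsum_cong' refl) (use g in \<open>auto simp del: of_nat_diff\<close>)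
    then have "(\<Oplus>\<^bsub>G\<^esub>i\<in>{..m}. g i (m - i)) = (\<Oplus>\<^bsub>G\<^esub>i\<in>{..m}.
        d i (a + int m - int (m - i)) (n - (a + int m) + int (m - i) - 1)
        (d (m - i) (a + int m) (n - (a + int m)) (x (a + int m))))" ..
    also have "\<dots> = \<zero>\<^bsub>G\<^esub>"
      using structure_relation[OF Tot_filtD(2)[OF p, of "a + int m"], where n = m]
      by (simp add: G_def algebra_simps)
    finally show "(\<Oplus>\<^bsub>G\<^esub>i\<in>{..m}. g i (m - i)) = \<zero>\<^bsub>G\<^esub>" .
  qed auto
  also have "\<dots> = \<zero>\<^bsub>G\<^esub>"
    by simp
  finally show "tot_diff C d (n - 1) (tot_diff C d n x) a = \<zero>\<^bsub>Tot C (n - 2)\<^esub> a"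
    by (simp add: Tot_sel G_def)
qed

lemma tot_diff_hom: "abelian_group_hom (Tot C n) (Tot C (n - 1)) (tot_diff C d n)"
  by (rule linear_map_abelian_group_hom[OF module_Tot module_Tot tot_diff_linear])

section \<open>Cycles and boundaries of the filtered complex\<close>

lemma cycles_totD:
  assumes "x \<in> cycles_tot C d r p n"
  shows "x \<in> Tot_filt C p n" "tot_diff C d n x \<in> Tot_filt C (p - int r) (n - 1)"
    "x \<in> carrier (Tot C n)"
  using assms by (auto simp: cycles_tot_def Tot_filt_def)

lemma cycles_tot_submodule: "submodule (cycles_tot C d r p n) R (Tot C n)"
  unfolding cycles_tot_def
  by (rule linear_map_submodule_vimage[OF module_Tot module_Tot tot_diff_linear
      Tot_filt_submodule Tot_filt_submodule])

text \<open>The page index s is arbitrary because d d x = 0 lies in every filtration step.\<close>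

lemma tot_diff_cycles_tot:
  assumes "x \<in> cycles_tot C d r p n"
  shows "tot_diff C d n x \<in> cycles_tot C d s (p - int r) (n - 1)"
  using cycles_totD[OF assms] T.submodule_mem(2)[OF Tot_filt_submodule]
  by (simp add: cycles_tot_def tot_diff_tot_diff)

text \<open>Both sides ask the differential to land in the same step, since (p - 1) - (r - 1) = p -
  r.\<close>

lemma cycles_tot_pred:
  assumes "r \<ge> 1" "x \<in> cycles_tot C d (r - 1) (p - 1) n"
  shows "x \<in> cycles_tot C d r p n"
  using cycles_totD[OF assms(2)] assms(1) Tot_filt_mono[of "p - 1" p x n]
  by (simp add: cycles_tot_def of_nat_diff)

lemma tot_diff_cycles_tot_pred:
  assumes "r \<ge> 1" "c \<in> cycles_tot C d (r - 1) (p + int r - 1) (n + 1)"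
  shows "tot_diff C d (n + 1) c \<in> cycles_tot C d s p n"
  using tot_diff_cycles_tot[OF assms(2), of s] assms(1) by (simp add: of_nat_diff)

lemma boundaries_tot_iff:
  "x \<in> boundaries_tot C d r p n \<longleftrightarrow>
    (\<exists>u\<in>cycles_tot C d (r - 1) (p - 1) n. \<exists>c\<in>cycles_tot C d (r - 1) (p + int r - 1) (n + 1).
      x = u \<oplus>\<^bsub>Tot C n\<^esub> tot_diff C d (n + 1) c)"
  by (auto simp: boundaries_tot_def set_add_def')

lemma boundaries_tot_submodule: "submodule (boundaries_tot C d r p n) R (Tot C n)"
  unfolding boundaries_tot_def
  using linear_map_submodule_image[OF module_Tot module_Tot tot_diff_linear cycles_tot_submodule,
      of "n + 1" "r - 1" "p + int r - 1"]
  by (intro T.submodule_set_add cycles_tot_submodule) simp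

lemma boundaries_tot_subset:
  assumes "r \<ge> 1"
  shows "boundaries_tot C d r p n \<subseteq> cycles_tot C d r p n"
proof
  fix x assume "x \<in> boundaries_tot C d r p n"
  then obtain u c where "u \<in> cycles_tot C d (r - 1) (p - 1) n"
      "c \<in> cycles_tot C d (r - 1) (p + int r - 1) (n + 1)"
      "x = u \<oplus>\<^bsub>Tot C n\<^esub> tot_diff C d (n + 1) c"
    by (auto simp: boundaries_tot_iff)
  then show "x \<in> cycles_tot C d r p n"
    using T.submodule_mem(3)[OF cycles_tot_submodule] cycles_tot_pred tot_diff_cycles_tot_pred assms
    by blast
qed

text \<open>For x = u + d c only d u survives. It is a boundary of the second kind in filtration
  degree p - r, because u has filtration degree p - 1 = (p - r) + r - 1; the first summand is taken
  to be zero.\<close>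

lemma tot_diff_boundaries_tot:
  assumes "r \<ge> 1" and x: "x \<in> boundaries_tot C d r p n"
  shows "tot_diff C d n x \<in> boundaries_tot C d r (p - int r) (n - 1)"
proof -
  interpret D: abelian_group_hom "Tot C n" "Tot C (n - 1)" "tot_diff C d n"
    by (rule tot_diff_hom)
  obtain u c where u: "u \<in> cycles_tot C d (r - 1) (p - 1) n"
    and c: "c \<in> cycles_tot C d (r - 1) (p + int r - 1) (n + 1)"
    and eq: "x = u \<oplus>\<^bsub>Tot C n\<^esub> tot_diff C d (n + 1) c"
    using x by (auto simp: boundaries_tot_iff)
  have "tot_diff C d (n + 1) c \<in> carrier (Tot C n)"
    using tot_diff_cycles_tot_pred[OF assms(1) c] by (rule cycles_totD)
  moreover have "tot_diff C d n (tot_diff C d (n + 1) c) = \<zero>\<^bsub>Tot C (n - 1)\<^esub>"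
    using tot_diff_tot_diff[OF cycles_totD(3)[OF c]] by simp
  ultimately have "tot_diff C d n x = \<zero>\<^bsub>Tot C (n - 1)\<^esub> \<oplus>\<^bsub>Tot C (n - 1)\<^esub> tot_diff C d n u"
    using cycles_totD(3)[OF u] by (simp add: eq)
  moreover have "\<zero>\<^bsub>Tot C (n - 1)\<^esub> \<in> cycles_tot C d (r - 1) (p - int r - 1) (n - 1)"
    by (rule T.submodule_mem(2)[OF cycles_tot_submodule])
  ultimately show ?thesis
    using u by (auto simp: boundaries_tot_iff)
qed

subsection \<open>Zigzags as cycles of the total complex\<close>

text \<open>The index set \<open>I\<close> is kept general for two uses: all i < k gives the zigzag
  equations for k < r, and {1..r - 1} with k = r gives \<open>Delta_rep\<close>.\<close>

lemma tot_diff_below_top: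
  assumes w: "w \<in> Tot_filt C p n" and I: "I \<subseteq> {..<k}"
    and z: "\<And>i. i \<in> I \<Longrightarrow> z (p - int k + int i) \<in> carrier (C (p - int k + int i) (n - (p - int k + int i)))"
    and wz: "\<And>i. i \<in> I \<Longrightarrow> w (p - int k + int i)
        = \<ominus>\<^bsub>C (p - int k + int i) (n - (p - int k + int i))\<^esub> z (p - int k + int i)"
    and w0: "\<And>i. i < k \<Longrightarrow> i \<notin> I \<Longrightarrow> w (p - int k + int i)
        = \<zero>\<^bsub>C (p - int k + int i) (n - (p - int k + int i))\<^esub>"
  shows "tot_diff C d n w (p - int k) = d k p (n - p) (w p)
    \<ominus>\<^bsub>C (p - int k) (n - p + int k - 1)\<^esub> (\<Oplus>\<^bsub>C (p - int k) (n - p + int k - 1)\<^esub>i\<in>I.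
        d i (p - int k + int i) (n - p + int k - int i) (z (p - int k + int i)))"
proof -
  define G where "G = C (p - int k) (n - p + int k - 1)"
  interpret G: module R G
    unfolding G_def by (rule component_module)
  define g where "g i = d i (p - int k + int i) (n - p + int k - int i)" for i
  have deg: "n - (p - int k + int i) = n - p + int k - int i" for i
    by simp
  have g: "abelian_group_hom (C (p - int k + int i) (n - p + int k - int i)) G (g i)" for i
    unfolding g_def G_def by (rule d_hom) auto
  have gz: "g i (z (p - int k + int i)) \<in> carrier G" if "i \<in> I" for i
    using abelian_group_hom.hom_closed[OF g z[OF that, unfolded deg]] .
  have fin: "finite I" "k \<notin> I"
    using I finite_subset by auto
  have top: "g k (w p) \<in> carrier G"
    using abelian_group_hom.hom_closed[OF g[of k]] Tot_filtD(2)[OF w, of p] by simp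
  \<comment> \<open>Index k is the leading component at p. Larger indices exceed the filtration
    degree, and smaller ones outside \<open>I\<close> vanish by \<open>w0\<close>.\<close>
  have "tot_diff C d n w (p - int k) = (\<Oplus>\<^bsub>G\<^esub>i\<in>insert k I. g i (w (p - int k + int i)))"
  proof (subst tot_diff_eq_finsum[OF Tot_filtD(1)[OF w]])
    show "w (p - int k + int i) = \<zero>\<^bsub>C (p - int k + int i) (n - (p - int k + int i))\<^esub>"
      if "i \<notin> insert k I" for i
      using that w0 Tot_filtD(3)[OF w, of "p - int k + int i"] by (cases "i < k") auto
  qed (use fin in \<open>simp_all add: G_def g_def algebra_simps\<close>)
  also have "\<dots> = (\<Oplus>\<^bsub>G\<^esub>i\<in>insert k I. if i = k then g k (w p) else \<ominus>\<^bsub>G\<^esub> g i (z (p - int k + int i)))"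
  proof (rule G.M.finsum_cong')
    fix i assume "i \<in> insert k I"
    then show "g i (w (p - int k + int i))
        = (if i = k then g k (w p) else \<ominus>\<^bsub>G\<^esub> g i (z (p - int k + int i)))"
      using wz z abelian_group_hom.hom_a_inv[OF g, of "z (p - int k + int i)" i]
      by (auto simp: deg)
  qed (use top gz in auto)
  also have "\<dots> = g k (w p) \<oplus>\<^bsub>G\<^esub> (\<Oplus>\<^bsub>G\<^esub>i\<in>I. \<ominus>\<^bsub>G\<^esub> g i (z (p - int k + int i)))"
    using fin top gz by (subst G.M.finsum_insert) (auto intro!: arg_cong2[where f = "add G"] G.M.finsum_cong')
  also have "\<dots> = g k (w p) \<ominus>\<^bsub>G\<^esub> (\<Oplus>\<^bsub>G\<^esub>i\<in>I. g i (z (p - int k + int i)))"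
    using gz by (subst G.M.finsum_uminus) (auto simp: a_minus_def)
  finally show ?thesis
    by (simp add: g_def G_def)
qed

text \<open>Only the r components at p - k with k < r separate the two steps; applied to d w they
  become the r equations of a zigzag.\<close>

lemma Tot_filt_lower_iff:
  assumes "x \<in> Tot_filt C p n"
  shows "x \<in> Tot_filt C (p - int r) n \<longleftrightarrow>
    (\<forall>k<r. x (p - int k) = \<zero>\<^bsub>C (p - int k) (n - (p - int k))\<^esub>)"
proof
  assume *: "\<forall>k<r. x (p - int k) = \<zero>\<^bsub>C (p - int k) (n - (p - int k))\<^esub>"
  have "x a = \<zero>\<^bsub>C a (n - a)\<^esub>" if "p - int r < a" for a
  proof (cases "a \<le> p")
    case True
    then show ?thesis
      using * that by (auto dest: spec[where x = "nat (p - a)"])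
  qed (use Tot_filtD(3)[OF assms] in auto)
  then show "x \<in> Tot_filt C (p - int r) n"
    using Tot_filtD(1)[OF assms] by (simp add: Tot_filt_def)
qed (auto intro!: Tot_filtD(3))

text \<open>Components of w at or below p - r are left free, since component a of d w only sees
  degrees \<ge> a. This lets the equivalence serve both to lift a zigzag and to read one off an
  arbitrary cycle.\<close>

lemma zigzag_iff_cycles_tot:
  assumes w: "w \<in> Tot_filt C p n"
    and z: "\<And>j. j \<in> {1..r - 1} \<Longrightarrow> z (p - int j) \<in> carrier (C (p - int j) (n - (p - int j)))"
    and wz: "\<And>j. j \<in> {1..r - 1} \<Longrightarrow>
      w (p - int j) = \<ominus>\<^bsub>C (p - int j) (n - (p - int j))\<^esub> z (p - int j)"
    and "r \<ge> 1"
  shows "zigzag C d r p (n - p) (w p) z \<longleftrightarrow> w \<in> cycles_tot C d r p n"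
proof -
  define S where "S k = (\<Oplus>\<^bsub>C (p - int k) (n - p + int k - 1)\<^esub>i\<in>{..<k}.
      d i (p - int k + int i) (n - p + int k - int i) (z (p - int k + int i)))" for k
  have deg: "n - p + int j = n - (p - int j)" for j
    by simp
  have idx: "p - int k + int i = p - int (k - i)" "k - i \<in> {1..r - 1}" if "i < k" "k < r" for i k
    using that by auto
  have S: "S k \<in> carrier (C (p - int k) (n - p + int k - 1))" if "k < r" for k
    unfolding S_def
  proof (rule C.M.finsum_closed, rule funcsetI)
    fix i assume "i \<in> {..<k}"
    then show "d i (p - int k + int i) (n - p + int k - int i) (z (p - int k + int i))
        \<in> carrier (C (p - int k) (n - p + int k - 1))"
      using z[OF idx(2), of i k] that by (intro d_closed) (auto simp: of_nat_diff algebra_simps)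
  qed
  have top: "w p \<in> carrier (C p (n - p))"
    by (rule Tot_filtD[OF w])
  have dk: "d k p (n - p) (w p) \<in> carrier (C (p - int k) (n - p + int k - 1))" for k
    using top by (rule d_closed) auto
  have eq: "tot_diff C d n w (p - int k)
      = d k p (n - p) (w p) \<ominus>\<^bsub>C (p - int k) (n - p + int k - 1)\<^esub> S k" if "k < r" for k
    unfolding S_def
  proof (rule tot_diff_below_top[OF w])
    fix i assume "i \<in> {..<k}"
    then have i: "i < k"
      by simp
    note idx = idx(1)[OF i that] idx(2)[OF i that]
    show "z (p - int k + int i) \<in> carrier (C (p - int k + int i) (n - (p - int k + int i)))"
      unfolding idx(1) by (rule z[OF idx(2)])
    show "w (p - int k + int i)
        = \<ominus>\<^bsub>C (p - int k + int i) (n - (p - int k + int i))\<^esub> z (p - int k + int i)"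
      unfolding idx(1) by (rule wz[OF idx(2)])
  qed auto
  have "tot_diff C d n w (p - int k) = \<zero>\<^bsub>C (p - int k) (n - p + int k - 1)\<^esub>
      \<longleftrightarrow> d k p (n - p) (w p) = S k" if "k < r" for k
    unfolding eq[OF that] by (rule C.M.minus_eq_zero_iff[OF dk S[OF that]])
  moreover have deg': "n - 1 - (p - int k) = n - p + int k - 1" for k
    by simp
  ultimately have "w \<in> cycles_tot C d r p n \<longleftrightarrow> (\<forall>k<r. d k p (n - p) (w p) = S k)"
    using w by (simp add: cycles_tot_def Tot_filt_lower_iff[OF tot_diff_Tot_filt[OF w], unfolded deg'])
  \<comment> \<open>The equation for k = 0 has an empty right-hand sum and becomes the separate
    condition d_0 x = 0.\<close>
  also have "\<dots> \<longleftrightarrow> d 0 p (n - p) (w p) = S 0 \<and> (\<forall>k\<in>{1..r - 1}. d k p (n - p) (w p) = S k)"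
  proof -
    have "k < r \<longleftrightarrow> k = 0 \<or> k \<in> {1..r - 1}" for k
      using \<open>r \<ge> 1\<close> by auto
    then show ?thesis
      by (auto simp del: atLeastAtMost_iff)
  qed
  also have "\<dots> \<longleftrightarrow> zigzag C d r p (n - p) (w p) z"
  proof -
    have "{0..k - 1} = {..<k}" if "k \<in> {1..r - 1}" for k
      using that by auto
    moreover have "S 0 = \<zero>\<^bsub>C p (n - p - 1)\<^esub>"
      by (simp add: S_def)
    moreover have "\<forall>j\<in>{1..r - 1}. z (p - int j) \<in> carrier (C (p - int j) (n - p + int j))"
      using z unfolding deg by blast
    ultimately show ?thesis
      using top by (simp add: zigzag_def S_def)
  qed
  finally show ?thesis by blast
qed

text \<open>The value at p - r itself is zero, not merely the values below, so that no d_0 term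
  enters component p - r of the differential. This matches the sum in \<open>Delta_rep\<close>,
  which starts at i = 1.\<close>

definition zigzag_lift :: "nat \<Rightarrow> int \<Rightarrow> int \<Rightarrow> 'm \<Rightarrow> (int \<Rightarrow> 'm) \<Rightarrow> int \<Rightarrow> 'm"
  where "zigzag_lift r p n x z = (\<lambda>a. if a = p then x
    else if p - int r < a \<and> a < p then \<ominus>\<^bsub>C a (n - a)\<^esub> z a else \<zero>\<^bsub>C a (n - a)\<^esub>)"

lemma zigzag_lift_top [simp]: "zigzag_lift r p n x z p = x"
  by (simp add: zigzag_lift_def)

lemma zigzag_carrier:
  assumes "zigzag C d r p (n - p) x z"
  shows "x \<in> carrier (C p (n - p))" "p - int r < a \<Longrightarrow> a < p \<Longrightarrow> z a \<in> carrier (C a (n - a))"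
proof -
  show "x \<in> carrier (C p (n - p))"
    using assms by (simp add: zigzag_def)
  have "\<forall>j\<in>{1..r - 1}. z (p - int j) \<in> carrier (C (p - int j) (n - p + int j))"
    using assms by (simp add: zigzag_def)
  from bspec[OF this, of "nat (p - a)"]
  show "z a \<in> carrier (C a (n - a))" if a: "p - int r < a" "a < p"
  proof -
    have "nat (p - a) \<in> {1..r - 1}"
      using a by auto
    with \<open>_ \<Longrightarrow> _\<close> show ?thesis
      using a by simp
  qed
qed

lemma zigzag_lift_filt:
  assumes "zigzag C d r p (n - p) x z"
  shows "zigzag_lift r p n x z \<in> Tot_filt C p n"
  by (rule Tot_filtI) (auto simp: zigzag_lift_def zigzag_carrier[OF assms])

lemma zigzag_lift_cycles_tot:
  assumes "zigzag C d r p (n - p) x z" "r \<ge> 1"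
  shows "zigzag_lift r p n x z \<in> cycles_tot C d r p n"
  using assms
  by (subst zigzag_iff_cycles_tot[OF zigzag_lift_filt[OF assms(1)], symmetric, where z = z])
    (auto simp: zigzag_lift_def intro!: zigzag_carrier[OF assms(1)])

lemma tot_diff_zigzag_lift:
  assumes "zigzag C d r p (n - p) x z" "r \<ge> 1"
  shows "tot_diff C d n (zigzag_lift r p n x z) (p - int r) = Delta_rep C d r p (n - p) x z"
proof -
  have "tot_diff C d n (zigzag_lift r p n x z) (p - int r) = d r p (n - p) (zigzag_lift r p n x z p)
    \<ominus>\<^bsub>C (p - int r) (n - p + int r - 1)\<^esub> (\<Oplus>\<^bsub>C (p - int r) (n - p + int r - 1)\<^esub>i\<in>{1..r - 1}.
        d i (p - int r + int i) (n - p + int r - int i) (z (p - int r + int i)))"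
    by (rule tot_diff_below_top[OF zigzag_lift_filt[OF assms(1)]])
      (use assms(2) in \<open>auto simp: zigzag_lift_def intro!: zigzag_carrier[OF assms(1)]\<close>)
  then show ?thesis
    by (simp add: Delta_rep_def)
qed

lemma cycles_tot_zigzag:
  assumes "w \<in> cycles_tot C d r p n" "r \<ge> 1"
  shows "zigzag C d r p (n - p) (w p) (\<lambda>a. \<ominus>\<^bsub>C a (n - a)\<^esub> w a)"
  using cycles_totD[OF assms(1)] assms Tot_filtD(2)[OF cycles_totD(1)[OF assms(1)]]
  by (subst zigzag_iff_cycles_tot) auto

text \<open>Zigzags lift and total cycles restrict to zigzags. As a linear image
  \<open>cycles\<close> is a submodule, and the projection from total cycles onto it is
  surjective.\<close>

lemma cycles_eq_image:
  assumes "r \<ge> 1"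
  shows "cycles C d r p (n - p) = (\<lambda>x. x p) ` cycles_tot C d r p n"
proof (intro equalityI subsetI)
  fix x assume "x \<in> cycles C d r p (n - p)"
  then obtain z where "zigzag C d r p (n - p) x z"
    by (auto simp: cycles_def)
  then show "x \<in> (\<lambda>x. x p) ` cycles_tot C d r p n"
    using zigzag_lift_cycles_tot[OF _ assms] by (intro image_eqI[of x _ "zigzag_lift r p n x z"]) auto
next
  fix x assume "x \<in> (\<lambda>x. x p) ` cycles_tot C d r p n"
  then show "x \<in> cycles C d r p (n - p)"
    using cycles_tot_zigzag[OF _ assms] by (auto simp: cycles_def)
qed

section \<open>Boundaries as leading components of differentials\<close>

lemma tot_diff_above:
  assumes c: "c \<in> Tot_filt C (p + int r - 1) (n + 1)" and l: "l \<le> r - 1" and "r \<ge> 1"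
    and c': "\<And>j. j \<le> r - 1 \<Longrightarrow> c' (p + int j) = c (p + int j)"
  shows "tot_diff C d (n + 1) c (p + int l) = (\<Oplus>\<^bsub>C (p + int l) (n - p - int l)\<^esub>j\<in>{l..r - 1}.
    d (j - l) (p + int j) (n - p - int j + 1) (c' (p + int j)))"
proof -
  define G where "G = C (p + int l) (n - p - int l)"
  interpret G: module R G
    unfolding G_def by (rule component_module)
  define g where "g j = d (j - l) (p + int j) (n - p - int j + 1) (c' (p + int j))" for j
  have g: "g j \<in> carrier G" if "j \<in> {l..r - 1}" for j
    unfolding g_def G_def
  proof (rule d_closed)
    show "c' (p + int j) \<in> carrier (C (p + int j) (n - p - int j + 1))"
      using Tot_filtD(2)[OF c, of "p + int j"] c'[of j] that by (simp add: algebra_simps)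
  qed (use that in auto)
  have N: "p + int r - 1 \<le> p + int l + int (r - 1 - l)"
    using l \<open>r \<ge> 1\<close> by simp
  \<comment> \<open>The total differential indexes by the order i of the structure map,
    \<open>boundaries\<close> by the column offset j = i + l.\<close>
  have img: "(\<lambda>i. i + l) ` {..r - 1 - l} = {l..r - 1}"
    using l by (simp add: atMost_atLeast0 image_add_atLeastAtMost')
  have "tot_diff C d (n + 1) c (p + int l) = (\<Oplus>\<^bsub>G\<^esub>i\<in>{..r - 1 - l}.
      d i (p + int l + int i) (n + 1 - (p + int l + int i)) (c (p + int l + int i)))"
    unfolding tot_diff_eq_finsum_atMost[OF c N] by (simp add: G_def algebra_simps)
  also have "\<dots> = (\<Oplus>\<^bsub>G\<^esub>i\<in>{..r - 1 - l}. g (i + l))"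
  proof (rule G.M.finsum_cong')
    fix i assume i: "i \<in> {..r - 1 - l}"
    then have "c' (p + int (i + l)) = c (p + int (i + l))"
      using l by (intro c') auto
    then show "d i (p + int l + int i) (n + 1 - (p + int l + int i)) (c (p + int l + int i)) = g (i + l)"
      by (simp add: g_def algebra_simps)
  qed (use g l in auto)
  also have "\<dots> = (\<Oplus>\<^bsub>G\<^esub>j\<in>{l..r - 1}. g j)"
    using G.M.finsum_reindex[of g "\<lambda>i. i + l" "{..r - 1 - l}"] g
    unfolding img by (simp add: Pi_def)
  finally show ?thesis
    by (simp add: g_def G_def)
qed

text \<open>Since (p + r - 1) - (r - 1) = p, the condition is that d c lies in step p. The r - 1
  listed degrees suffice, as d c already vanishes above p + r - 1.\<close>

lemma cycles_tot_pred_iff: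
  assumes c: "c \<in> Tot_filt C (p + int r - 1) (n + 1)" and "r \<ge> 1"
  shows "c \<in> cycles_tot C d (r - 1) (p + int r - 1) (n + 1) \<longleftrightarrow>
    (\<forall>l\<in>{1..r - 1}. tot_diff C d (n + 1) c (p + int l) = \<zero>\<^bsub>C (p + int l) (n - p - int l)\<^esub>)"
proof -
  have filt: "tot_diff C d (n + 1) c \<in> Tot_filt C (p + int r - 1) n"
    using tot_diff_Tot_filt[OF c] by simp
  have "c \<in> cycles_tot C d (r - 1) (p + int r - 1) (n + 1) \<longleftrightarrow>
      (\<forall>a>p. tot_diff C d (n + 1) c a = \<zero>\<^bsub>C a (n - a)\<^esub>)"
    using c filt \<open>r \<ge> 1\<close> by (auto simp: cycles_tot_def Tot_filt_def of_nat_diff)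
  also have "\<dots> \<longleftrightarrow> (\<forall>l\<in>{1..r - 1}. tot_diff C d (n + 1) c (p + int l) = \<zero>\<^bsub>C (p + int l) (n - p - int l)\<^esub>)"
  proof (intro iffI allI impI ballI)
    fix l assume "\<forall>a>p. tot_diff C d (n + 1) c a = \<zero>\<^bsub>C a (n - a)\<^esub>" "l \<in> {1..r - 1}"
    then show "tot_diff C d (n + 1) c (p + int l) = \<zero>\<^bsub>C (p + int l) (n - p - int l)\<^esub>"
      by (simp add: diff_diff_eq)
  next
    fix a assume *: "\<forall>l\<in>{1..r - 1}. tot_diff C d (n + 1) c (p + int l) = \<zero>\<^bsub>C (p + int l) (n - p - int l)\<^esub>"
      and a: "p < a"
    show "tot_diff C d (n + 1) c a = \<zero>\<^bsub>C a (n - a)\<^esub>"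
    proof (cases "a \<le> p + int r - 1")
      case True
      then have "nat (a - p) \<in> {1..r - 1}"
        using a by auto
      from bspec[OF * this] show ?thesis
        using a by (simp add: algebra_simps)
    qed (use Tot_filtD(3)[OF filt] in auto)
  qed
  finally show ?thesis .
qed

lemma boundaries_eq_image_tot_diff:
  assumes "r \<ge> 1"
  shows "boundaries C d r p (n - p)
    = (\<lambda>c. tot_diff C d (n + 1) c p) ` cycles_tot C d (r - 1) (p + int r - 1) (n + 1)"
proof (intro equalityI subsetI)
  fix x assume "x \<in> boundaries C d r p (n - p)"
  then obtain c where c: "\<forall>j\<in>{0..r - 1}. c (p + int j) \<in> carrier (C (p + int j) (n - p - int j + 1))"
    and x: "x = (\<Oplus>\<^bsub>C p (n - p)\<^esub>j\<in>{0..r - 1}. d j (p + int j) (n - p - int j + 1) (c (p + int j)))"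
    and zero: "\<forall>l\<in>{1..r - 1}. \<zero>\<^bsub>C (p + int l) (n - p - int l)\<^esub> =
       (\<Oplus>\<^bsub>C (p + int l) (n - p - int l)\<^esub>j\<in>{l..r - 1}.
          d (j - l) (p + int j) (n - p - int j + 1) (c (p + int j)))"
    unfolding boundaries_def by blast
  \<comment> \<open>The given family is unconstrained outside the degrees p to p + r - 1; extension
    by zero makes it an element of the total complex.\<close>
  define e where "e a = (if p \<le> a \<and> a < p + int r then c a else \<zero>\<^bsub>C a (n + 1 - a)\<^esub>)" for a
  have e: "e \<in> Tot_filt C (p + int r - 1) (n + 1)"
  proof (rule Tot_filtI)
    show "e a \<in> carrier (C a (n + 1 - a))" for a
    proof (cases "p \<le> a \<and> a < p + int r")
      case True
      then have "nat (a - p) \<in> {0..r - 1}"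
        by auto
      from bspec[OF c this] show ?thesis
        using True by (simp add: e_def algebra_simps)
    qed (auto simp: e_def)
  qed (auto simp: e_def)
  \<comment> \<open>The equations speak of \<open>c\<close> but the differential is applied to
    \<open>e\<close>; \<open>tot_diff_above\<close> only needs the two to agree on the
    window.\<close>
  have ec: "c (p + int j) = e (p + int j)" if "j \<le> r - 1" for j
    using that assms by (auto simp: e_def)
  note eq = tot_diff_above[OF e _ assms ec]
  have "e \<in> cycles_tot C d (r - 1) (p + int r - 1) (n + 1)"
    unfolding cycles_tot_pred_iff[OF e assms]
  proof
    fix l assume "l \<in> {1..r - 1}"
    then show "tot_diff C d (n + 1) e (p + int l) = \<zero>\<^bsub>C (p + int l) (n - p - int l)\<^esub>"
      using zero eq[of l] by simp
  qed
  moreover have "x = tot_diff C d (n + 1) e p"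
    using eq[of 0] x by simp
  ultimately show "x \<in> (\<lambda>c. tot_diff C d (n + 1) c p) ` cycles_tot C d (r - 1) (p + int r - 1) (n + 1)"
    by blast
next
  fix x assume "x \<in> (\<lambda>c. tot_diff C d (n + 1) c p) ` cycles_tot C d (r - 1) (p + int r - 1) (n + 1)"
  then obtain c where c: "c \<in> cycles_tot C d (r - 1) (p + int r - 1) (n + 1)"
    and x: "x = tot_diff C d (n + 1) c p"
    by blast
  note filt = cycles_totD(1)[OF c]
  note eq = tot_diff_above[OF filt _ assms refl]
  show "x \<in> boundaries C d r p (n - p)"
    unfolding boundaries_def
  proof (intro CollectI conjI exI[of _ c] ballI)
    show "x \<in> carrier (C p (n - p))"
      unfolding x by (rule Tot_filtD[OF cycles_totD(1)[OF tot_diff_cycles_tot_pred[OF assms c]]])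
    show "c (p + int j) \<in> carrier (C (p + int j) (n - p - int j + 1))" for j
      using Tot_filtD(2)[OF filt, of "p + int j"] by (simp add: algebra_simps)
    show "x = (\<Oplus>\<^bsub>C p (n - p)\<^esub>j\<in>{0..r - 1}. d j (p + int j) (n - p - int j + 1) (c (p + int j)))"
      using eq[of 0] x by simp
    show "\<zero>\<^bsub>C (p + int l) (n - p - int l)\<^esub> = (\<Oplus>\<^bsub>C (p + int l) (n - p - int l)\<^esub>j\<in>{l..r - 1}.
          d (j - l) (p + int j) (n - p - int j + 1) (c (p + int j)))" if "l \<in> {1..r - 1}" for l
      using c[unfolded cycles_tot_pred_iff[OF filt assms]] that eq[of l] by simp
  qed
qed

text \<open>Gives injectivity of \<open>psi\<close>. Left to right, u has no component at p, so the
  leading component of x is that of d c. Conversely x - d c has zero leading component, hence drops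
  to step p - 1 while its differential stays in step p - r = (p - 1) - (r - 1).\<close>

lemma boundaries_tot_proj_iff:
  assumes "r \<ge> 1" and x: "x \<in> cycles_tot C d r p n"
  shows "x \<in> boundaries_tot C d r p n \<longleftrightarrow> x p \<in> boundaries C d r p (n - p)"
proof
  assume "x \<in> boundaries_tot C d r p n"
  then obtain u c where u: "u \<in> cycles_tot C d (r - 1) (p - 1) n"
    and c: "c \<in> cycles_tot C d (r - 1) (p + int r - 1) (n + 1)"
    and eq: "x = u \<oplus>\<^bsub>Tot C n\<^esub> tot_diff C d (n + 1) c"
    by (auto simp: boundaries_tot_iff)
  have "u p = \<zero>\<^bsub>C p (n - p)\<^esub>"
    by (rule Tot_filtD(3)[OF cycles_totD(1)[OF u]]) simp
  then have "x p = tot_diff C d (n + 1) c p"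
    using cycles_totD(3)[OF u] cycles_totD(3)[OF tot_diff_cycles_tot_pred[OF assms(1) c]]
    by (simp add: eq Tot_sel(3) Tot_carrierD)
  then show "x p \<in> boundaries C d r p (n - p)"
    using c by (auto simp: boundaries_eq_image_tot_diff[OF assms(1)])
next
  interpret P: abelian_group_hom "Tot C n" "C p (n - p)" "\<lambda>x. x p"
    by (rule linear_map_abelian_group_hom[OF module_Tot component_module proj_linear])
  assume "x p \<in> boundaries C d r p (n - p)"
  then obtain c where c: "c \<in> cycles_tot C d (r - 1) (p + int r - 1) (n + 1)"
    and xp: "x p = tot_diff C d (n + 1) c p"
    by (auto simp: boundaries_eq_image_tot_diff[OF assms(1)])
  define e where "e = tot_diff C d (n + 1) c"
  have e: "e \<in> cycles_tot C d r p n"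
    unfolding e_def by (rule tot_diff_cycles_tot_pred[OF assms(1) c])
  define u where "u = x \<ominus>\<^bsub>Tot C n\<^esub> e"
  have u: "u \<in> cycles_tot C d r p n"
    unfolding u_def by (rule T.submodule_mem(4)[OF cycles_tot_submodule x e])
  have "u p = \<zero>\<^bsub>C p (n - p)\<^esub>"
    using cycles_totD(3)[OF x] cycles_totD(3)[OF e] xp
    by (simp add: u_def a_minus_def Tot_carrierD C.r_neg e_def)
  then have "u a = \<zero>\<^bsub>C a (n - a)\<^esub>" if "p - 1 < a" for a
    using that Tot_filtD(3)[OF cycles_totD(1)[OF u], of a] by (cases "a = p") auto
  then have "u \<in> Tot_filt C (p - 1) n"
    using cycles_totD(3)[OF u] by (simp add: Tot_filt_def)
  then have "u \<in> cycles_tot C d (r - 1) (p - 1) n"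
    using cycles_totD(2)[OF u] assms(1) by (simp add: cycles_tot_def of_nat_diff)
  moreover have "x = u \<oplus>\<^bsub>Tot C n\<^esub> e"
    using cycles_totD(3)[OF x] cycles_totD(3)[OF e]
    by (simp add: u_def a_minus_def T.a_assoc T.l_neg)
  ultimately show "x \<in> boundaries_tot C d r p n"
    using c by (auto simp: boundaries_tot_iff e_def)
qed

subsection \<open>Comparison of the two descriptions of the pages\<close>

text \<open>Presents \<open>boundaries\<close> as the linear image of a submodule, from which its
  own submodule property is drawn.\<close>

lemma boundaries_eq_image:
  assumes "r \<ge> 1"
  shows "boundaries C d r p (n - p) = (\<lambda>x. x p) ` boundaries_tot C d r p n"
proof (intro equalityI subsetI)
  fix x assume "x \<in> boundaries C d r p (n - p)"
  then obtain c where c: "c \<in> cycles_tot C d (r - 1) (p + int r - 1) (n + 1)"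
    and x: "x = tot_diff C d (n + 1) c p"
    by (auto simp: boundaries_eq_image_tot_diff[OF assms])
  have "tot_diff C d (n + 1) c \<in> boundaries_tot C d r p n"
    using tot_diff_cycles_tot_pred[OF assms c] \<open>x \<in> _\<close>
    by (simp add: boundaries_tot_proj_iff[OF assms] x)
  then show "x \<in> (\<lambda>x. x p) ` boundaries_tot C d r p n"
    using x by blast
next
  fix x assume "x \<in> (\<lambda>x. x p) ` boundaries_tot C d r p n"
  then show "x \<in> boundaries C d r p (n - p)"
    using boundaries_tot_proj_iff[OF assms] boundaries_tot_subset[OF assms] by blast
qed

lemma proj_subquotient_map:
  assumes "r \<ge> 1"
  shows "subquotient_map R (Tot C n) (C p (n - p)) (\<lambda>x. x p)
    (cycles_tot C d r p n) (boundaries_tot C d r p n)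
    (cycles C d r p (n - p)) (boundaries C d r p (n - p))"
proof (rule subquotient_map.intro)
  show "submodule (cycles C d r p (n - p)) R (C p (n - p))"
    unfolding cycles_eq_image[OF assms]
    by (rule linear_map_submodule_image[OF module_Tot component_module proj_linear cycles_tot_submodule])
  show "submodule (boundaries C d r p (n - p)) R (C p (n - p))"
    unfolding boundaries_eq_image[OF assms]
    by (rule linear_map_submodule_image[OF module_Tot component_module proj_linear boundaries_tot_submodule])
qed (use boundaries_tot_subset[OF assms] in \<open>auto simp: module_Tot component_module proj_linear
    cycles_tot_submodule boundaries_tot_submodule cycles_eq_image[OF assms] boundaries_eq_image[OF assms]\<close>)

lemma tot_diff_subquotient_map:
  assumes "r \<ge> 1"
  shows "subquotient_map R (Tot C n) (Tot C (n - 1)) (tot_diff C d n)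
    (cycles_tot C d r p n) (boundaries_tot C d r p n)
    (cycles_tot C d r (p - int r) (n - 1)) (boundaries_tot C d r (p - int r) (n - 1))"
  by (rule subquotient_map.intro) (use boundaries_tot_subset[OF assms] in \<open>auto simp: module_Tot tot_diff_linear
    cycles_tot_submodule boundaries_tot_submodule tot_diff_cycles_tot tot_diff_boundaries_tot[OF assms]\<close>)

section \<open>The maps \<open>psi\<close>, \<open>page_diff\<close> and \<open>Delta\<close> on
  classes\<close>

lemma psi_class_tot:
  assumes "r \<ge> 1" "x \<in> cycles_tot C d r p n"
  shows "psi C d r p n (class_tot C d r p n x) = page_class C d r p (n - p) (x p)"
proof -
  interpret subquotient_map R "Tot C n" "C p (n - p)" "\<lambda>x. x p"
    "cycles_tot C d r p n" "boundaries_tot C d r p n" "cycles C d r p (n - p)" "boundaries C d r p (n - p)"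
    using assms(1) by (rule proj_subquotient_map)
  show ?thesis
    using induced_coset[OF assms(2)] by (simp add: psi_def page_class_def class_tot_def induced_def)
qed

lemma psi_iso:
  assumes "r \<ge> 1"
  shows "psi C d r p n \<in> linear_isos R (page_tot C d r p n) (page C d r p (n - p))"
proof -
  interpret subquotient_map R "Tot C n" "C p (n - p)" "\<lambda>x. x p"
    "cycles_tot C d r p n" "boundaries_tot C d r p n" "cycles C d r p (n - p)" "boundaries C d r p (n - p)"
    using assms by (rule proj_subquotient_map)
  have "psi C d r p n = induced"
    by (simp add: fun_eq_iff psi_def page_class_def induced_def)
  moreover have "induced \<in> linear_isos R (page_tot C d r p n) (page C d r p (n - p))"
    unfolding page_tot_def page_def
    by (rule induced_iso) (auto simp: boundaries_tot_proj_iff[OF assms] cycles_eq_image[OF assms])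
  ultimately show ?thesis
    by simp
qed

lemma page_diff_class_tot:
  assumes "r \<ge> 1" "x \<in> cycles_tot C d r p n"
  shows "page_diff C d r p n (class_tot C d r p n x)
    = class_tot C d r (p - int r) (n - 1) (tot_diff C d n x)"
proof -
  interpret subquotient_map R "Tot C n" "Tot C (n - 1)" "tot_diff C d n"
    "cycles_tot C d r p n" "boundaries_tot C d r p n"
    "cycles_tot C d r (p - int r) (n - 1)" "boundaries_tot C d r (p - int r) (n - 1)"
    using assms(1) by (rule tot_diff_subquotient_map)
  show ?thesis
    using induced_coset[OF assms(2)] by (simp add: page_diff_def class_tot_def induced_def)
qed

lemma page_diff_linear:
  assumes "r \<ge> 1"
  shows "page_diff C d r p n
    \<in> linear_maps R (page_tot C d r p n) (page_tot C d r (p - int r) (n - 1))"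
proof -
  interpret subquotient_map R "Tot C n" "Tot C (n - 1)" "tot_diff C d n"
    "cycles_tot C d r p n" "boundaries_tot C d r p n"
    "cycles_tot C d r (p - int r) (n - 1)" "boundaries_tot C d r (p - int r) (n - 1)"
    using assms by (rule tot_diff_subquotient_map)
  have "page_diff C d r p n = induced"
    by (simp add: fun_eq_iff page_diff_def class_tot_def induced_def)
  then show ?thesis
    using induced_linear by (simp add: page_tot_def)
qed

lemma page_tot_carrier:
  "carrier (page_tot C d r p n) = class_tot C d r p n ` cycles_tot C d r p n"
  by (simp add: page_tot_def subquotient_def class_tot_def)

lemma psi_page_diff_class_tot:
  assumes "r \<ge> 1" "x \<in> cycles_tot C d r p n"
  shows "psi C d r (p - int r) (n - 1) (page_diff C d r p n (class_tot C d r p n x))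
    = page_class C d r (p - int r) (n - p + int r - 1) (tot_diff C d n x (p - int r))"
proof -
  \<comment> \<open>Second degree of the target: total degree n - 1 in column p - r.\<close>
  have "n - 1 - (p - int r) = n - p + int r - 1"
    by simp
  then show ?thesis
    using psi_class_tot[OF assms(1) tot_diff_cycles_tot[OF assms(2)]]
    by (simp only: page_diff_class_tot[OF assms])
qed

text \<open>\<open>\<Delta>\<^sub>r\<close> is well defined because every zigzag starting in \<open>\<psi> X\<close> lifts to a cycle representing \<open>X\<close>.\<close>

lemma Delta_psi:
  assumes r: "r \<ge> 1" and X: "X \<in> carrier (page_tot C d r p n)"
  shows "Delta C d r p (n - p) (psi C d r p n X)
    = psi C d r (p - int r) (n - 1) (page_diff C d r p n X)"
proof -
  interpret subquotient_map R "Tot C n" "C p (n - p)" "\<lambda>x. x p"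
    "cycles_tot C d r p n" "boundaries_tot C d r p n" "cycles C d r p (n - p)" "boundaries C d r p (n - p)"
    using r by (rule proj_subquotient_map)
  interpret B': abelian_subgroup "boundaries C d r p (n - p)" "C p (n - p)"
    using B' by (rule C.abelian_subgroup_submodule)
  have inj: "inj_on (psi C d r p n) (carrier (page_tot C d r p n))"
    using psi_iso[OF r] by (auto simp: linear_isos_def bij_betw_def)
  obtain y where y: "y \<in> cycles_tot C d r p n" "X = class_tot C d r p n y"
    using X by (auto simp: page_tot_carrier)
  have yp: "y p \<in> carrier (C p (n - p))"
    using y(1) by (rule Tot_carrierD[OF cycles_totD(3)])
  have psi: "psi C d r p n X = page_class C d r p (n - p) (y p)"
    using psi_class_tot[OF r y(1)] y(2) by simp
  have "page_class C d r (p - int r) (n - p + int r - 1) (Delta_rep C d r p (n - p) x z)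
      = psi C d r (p - int r) (n - 1) (page_diff C d r p n X)"
    if x: "x \<in> psi C d r p n X" and zig: "zigzag C d r p (n - p) x z" for x z
  proof -
    define w where "w = zigzag_lift r p n x z"
    have w: "w \<in> cycles_tot C d r p n"
      unfolding w_def using zig r by (rule zigzag_lift_cycles_tot)
    \<comment> \<open>A member x of the coset represents the same class, so the lift w, whose
      leading component is x, has the same image under \<open>psi\<close> as X.\<close>
    have "page_class C d r p (n - p) x = psi C d r p n X"
      using B'.a_repr_independence'[of x "y p"] x yp unfolding psi page_class_def by simp
    then have "psi C d r p n (class_tot C d r p n w) = psi C d r p n X"
      using psi_class_tot[OF r w] by (simp add: w_def)
    then have "X = class_tot C d r p n w"
      using inj X w by (auto simp: page_tot_carrier dest: inj_onD)
    then show ?thesis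
      using psi_page_diff_class_tot[OF r w] tot_diff_zigzag_lift[OF zig r] by (simp add: w_def)
  qed
  \<comment> \<open>The set of candidate values is also nonempty: y p belongs to the class, and the
    negated components of y form a zigzag for it.\<close>
  moreover have "y p \<in> psi C d r p n X"
    unfolding psi page_class_def using yp by (rule B'.a_rcos_self)
  moreover have "zigzag C d r p (n - p) (y p) (\<lambda>a. \<ominus>\<^bsub>C a (n - a)\<^esub> y a)"
    using y(1) r by (rule cycles_tot_zigzag)
  ultimately have "{page_class C d r (p - int r) (n - p + int r - 1) (Delta_rep C d r p (n - p) x z) | x z.
      x \<in> psi C d r p n X \<and> zigzag C d r p (n - p) x z}
    = {psi C d r (p - int r) (n - 1) (page_diff C d r p n X)}"
    by (intro equalityI subsetI; clarsimp; metis)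
  then show ?thesis
    by (simp add: Delta_def)
qed

text \<open>The representative is the leading component of d w for the lift w, and d w is a cycle on
  every page.\<close>

lemma Delta_rep_cycles:
  assumes "zigzag C d r p (n - p) x z" "r \<ge> 1"
  shows "Delta_rep C d r p (n - p) x z \<in> cycles C d r (p - int r) (n - p + int r - 1)"
proof -
  have "n - 1 - (p - int r) = n - p + int r - 1"
    by simp
  moreover have "tot_diff C d n (zigzag_lift r p n x z) (p - int r)
      \<in> cycles C d r (p - int r) (n - 1 - (p - int r))"
    unfolding cycles_eq_image[OF assms(2)]
    using tot_diff_cycles_tot[OF zigzag_lift_cycles_tot[OF assms]] by blast
  ultimately show ?thesis
    by (simp only: tot_diff_zigzag_lift[OF assms])
qed

text \<open>Evaluates \<open>Delta_psi\<close> at the class of the lift, which \<open>psi\<close>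
  sends to the class of x; independence of the choices is already settled there.\<close>

lemma Delta_page_class:
  assumes "zigzag C d r p (n - p) x z" "r \<ge> 1"
  shows "Delta C d r p (n - p) (page_class C d r p (n - p) x)
    = page_class C d r (p - int r) (n - p + int r - 1) (Delta_rep C d r p (n - p) x z)"
proof -
  have w: "zigzag_lift r p n x z \<in> cycles_tot C d r p n"
    using assms by (rule zigzag_lift_cycles_tot)
  then have "class_tot C d r p n (zigzag_lift r p n x z) \<in> carrier (page_tot C d r p n)"
    by (simp add: page_tot_carrier)
  from Delta_psi[OF assms(2) this] show ?thesis
    using psi_class_tot[OF assms(2) w] psi_page_diff_class_tot[OF assms(2) w] tot_diff_zigzag_lift[OF assms]
    by simp
qed

lemma Delta_linear:
  assumes "r \<ge> 1"
  shows "Delta C d r p (n - p)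
    \<in> linear_maps R (page C d r p (n - p)) (page C d r (p - int r) (n - p + int r - 1))"
proof (rule linear_maps_factor_iso[OF psi_iso[OF assms, of p n]])
  have "n - 1 - (p - int r) = n - p + int r - 1"
    by simp
  then have "psi C d r (p - int r) (n - 1)
      \<in> linear_maps R (page_tot C d r (p - int r) (n - 1)) (page C d r (p - int r) (n - p + int r - 1))"
    using psi_iso[OF assms, of "p - int r" "n - 1"] by (simp only: linear_isos_def mem_Collect_eq)
  then show "(\<lambda>X. psi C d r (p - int r) (n - 1) (page_diff C d r p n X))
      \<in> linear_maps R (page_tot C d r p n) (page C d r (p - int r) (n - p + int r - 1))"
    by (rule linear_maps_comp[OF page_diff_linear[OF assms]])
next
  fix X Y
  assume "X \<in> carrier (page_tot C d r p n)" "Y \<in> carrier (page_tot C d r p n)"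
  then show "X \<oplus>\<^bsub>page_tot C d r p n\<^esub> Y \<in> carrier (page_tot C d r p n)"
    unfolding page_tot_def
    by (rule subquotient_add_closed[OF module_Tot cycles_tot_submodule boundaries_tot_submodule])
next
  fix s X
  assume "s \<in> carrier R" "X \<in> carrier (page_tot C d r p n)"
  then show "s \<odot>\<^bsub>page_tot C d r p n\<^esub> X \<in> carrier (page_tot C d r p n)"
    unfolding page_tot_def
    by (rule subquotient_smult_closed[OF module_Tot cycles_tot_submodule boundaries_tot_submodule])
qed (rule Delta_psi[OF assms])

end

theorem theorem2p10:
  fixes R :: "('k, 'x) ring_scheme"
    and C :: "int \<Rightarrow> int \<Rightarrow> ('k, 'm, 'y) module_scheme"
    and d :: "nat \<Rightarrow> int \<Rightarrow> int \<Rightarrow> 'm \<Rightarrow> 'm"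
    and r :: nat and p n :: int
  assumes "multicomplex R C d"
    and "r \<ge> 1"
  shows
    "(\<forall>(q, m) \<in> {(p, n), (p - int r, n - 1)}.
        (\<forall>x\<in>cycles_tot C d r q m.
           psi C d r q m (class_tot C d r q m x) = page_class C d r q (m - q) (x q)) \<and>
        psi C d r q m \<in> linear_isos R (page_tot C d r q m) (page C d r q (m - q))) \<and>
     (\<forall>x\<in>cycles_tot C d r p n.
        page_diff C d r p n (class_tot C d r p n x)
          = class_tot C d r (p - int r) (n - 1) (tot_diff C d n x)) \<and>
     page_diff C d r p n
       \<in> linear_maps R (page_tot C d r p n) (page_tot C d r (p - int r) (n - 1)) \<and>
     (\<forall>x z. zigzag C d r p (n - p) x z \<longrightarrow>
        Delta_rep C d r p (n - p) x z \<in> cycles C d r (p - int r) (n - p + int r - 1) \<and>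
        Delta C d r p (n - p) (page_class C d r p (n - p) x)
          = page_class C d r (p - int r) (n - p + int r - 1) (Delta_rep C d r p (n - p) x z)) \<and>
     Delta C d r p (n - p)
       \<in> linear_maps R (page C d r p (n - p)) (page C d r (p - int r) (n - p + int r - 1)) \<and>
     (\<forall>X\<in>carrier (page_tot C d r p n).
        psi C d r (p - int r) (n - 1) (page_diff C d r p n X)
          = Delta C d r p (n - p) (psi C d r p n X))"
proof -
  interpret multicomplex R C d by fact
  \<comment> \<open>Stated for all q and m, so that source and target of the differential are both
    covered.\<close>
  have "(\<forall>x\<in>cycles_tot C d r q m.
       psi C d r q m (class_tot C d r q m x) = page_class C d r q (m - q) (x q)) \<and>
      psi C d r q m \<in> linear_isos R (page_tot C d r q m) (page C d r q (m - q))" for q m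
    using psi_class_tot[OF assms(2)] psi_iso[OF assms(2)] by blast
  then show ?thesis
    by (intro conjI ballI allI impI case_prodI2)
      (simp_all only: page_diff_class_tot[OF assms(2)] page_diff_linear[OF assms(2)]
        Delta_rep_cycles[OF _ assms(2)] Delta_page_class[OF _ assms(2)] Delta_linear[OF assms(2)]
        Delta_psi[OF assms(2)])
qed

end
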